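(* Let $(M,X)$ be a closed pair of Polish spaces such that $M\setminus X$ is cellulated by a cell complex $L$ whose cells are scattered towards $X$, let $P$ be a subcomplex of $L$ and let $G$ be an abelian group. Then for each $n$ $$C_n^\kappa(P)=C_n^\nu(P)\qquad\text{and}\qquad C^n_\kappa(P)=C^n_\nu(P)$$ as subgroups of $\prod_{\sigma\in P_n}G_\sigma$. Moreover, the natural maps $$\operatorname{colim}_{K\in\kappa}\lim_{N\in\nu}C_*(P\cap K,\,P\cap K\cap N)\to\lim_{N\in\nu}\operatorname{colim}_{K\in\kappa}C_*(P\cap K,\,P\cap K\cap N),$$ $$\operatorname{colim}_{N\in\nu}\lim_{K\in\kappa}C^*(P\cap K,\,P\cap K\cap N)\to\lim_{K\in\kappa}\operatorname{colim}_{N\in\nu}C^*(P\cap K,\,P\cap K\cap N)$$ are isomorphisms of chain complexes and of cochain complexes; that is, $C_*^\kappa(P)\simeq C_*^\nu(P)$ and $C^*_\kappa(P)\simeq C^*_\nu(P)$ as (co)chain complexes.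
   Context: A Polish space is a separable completely metrizable space; a closed pair $(M,X)$ of Polish spaces consists of a Polish space $M$ and its closed subset $X$. A cell complex is a CW complex whose attaching maps are PL embeddings; $M\setminus X$ being cellulated by $L$ means that it is the underlying space of $L$ (not assumed locally finite; if it is not locally finite, it carries a metric topology rather than the weak topology). The cells of $L$ are scattered towards $X$ if whenever points $y_i$ of closed cells $\sigma_i$ of $L$ converge to some $x\in X$, any other sequence of points $y'_i\in\sigma_i$ also converges to $x$. $\kappa$ is the set of subcomplexes of $L$ with compact closure in $M$ (directed by inclusion); $\nu$ is the set of subcomplexes $N$ of $L$ such that $N\cup X$ is a neighborhood of $X$ in $M$ (directed by reverse inclusion); $\bar\nu$ is the set of subcomplexes of $L$ that are closed subsets of $M$. $P_n$ is the set of $n$-cells of $P$; $G_\sigma$ is a copy of $G$ for each $\sigma\in P_n$; for $g=(g_\sigma)\in\prod_{\sigma\in P_n}G_\sigma$, $\operatorname{supp}(g)=\{\sigma:g_\sigma\ne0\}$. The following are subgroups of $\prod_{\sigma\in P_n}G_\sigma$: $C_n^\kappa(P)=\{g:\operatorname{supp}(g)\subset K\text{ for some }K\in\kappa\}$, $C^n_\kappa(P)=\{g:\operatorname{supp}(g)\cap K\text{ is finite for each }K\in\kappa\}$, $C_n^\nu(P)=\{g:\operatorname{supp}(g)\cap F\text{ is finite for each }F\in\bar\nu\}$, $C^n_\nu(P)=\{g:\operatorname{supp}(g)\subset F\text{ for some }F\in\bar\nu\}$. $C_*(\cdot,\cdot)$ and $C^*(\cdot,\cdot)$ are the usual relative cellular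 (co)chain complexes with coefficients in $G$. As (co)chain complexes, $C_*^\kappa(P)\simeq\operatorname{colim}_{K}\lim_{N}C_*(P\cap K,P\cap K\cap N)$, $C^*_\kappa(P)\simeq\lim_K\operatorname{colim}_NC^*(P\cap K,P\cap K\cap N)$, $C_*^\nu(P)\simeq\lim_N\operatorname{colim}_KC_*(P\cap K,P\cap K\cap N)$, $C^*_\nu(P)\simeq\operatorname{colim}_N\lim_KC^*(P\cap K,P\cap K\cap N)$, where $K$ ranges over $\kappa$ and $N$ over $\nu$. *)

theory Defs
  imports "HOL-Homology.Homology" "HOL-Analysis.Analysis" "HOL-Analysis.Finite_Function_Topology"
begin

section \<open>Cell complexes\<close>

text \<open>
  \<open>\<real>\<^sup>n\<close> is the subspace of the real normed vector space \<^typ>\<open>nat \<Rightarrow>\<^sub>0 real\<close> of vectors supported in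
  \<open>{..<n}\<close>. The norm of this space is the \<open>l\<^sub>1\<close>-norm, so \<open>pl_disc n\<close> is the \<open>n\<close>-dimensional
  cross-polytope, a PL \<open>n\<close>-ball, and \<open>pl_sphere n\<close> is its boundary (empty for \<open>n = 0\<close>).
\<close>

definition pl_disc :: "nat \<Rightarrow> (nat \<Rightarrow>\<^sub>0 real) set" where
  "pl_disc n = {x. Poly_Mapping.keys x \<subseteq> {..<n} \<and> norm x \<le> 1}"

definition pl_sphere :: "nat \<Rightarrow> (nat \<Rightarrow>\<^sub>0 real) set" where
  "pl_sphere n = {x. Poly_Mapping.keys x \<subseteq> {..<n} \<and> norm x = 1}"

text \<open>\<open>S\<close> is a compact polyhedron and \<open>f\<close> is piecewise linear on it.\<close>

definition pl_on :: "'v::real_normed_vector set \<Rightarrow> ('v \<Rightarrow> 'w::real_normed_vector) \<Rightarrow> bool" where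
  "pl_on S f \<longleftrightarrow> continuous_on S f \<and>
     (\<exists>\<T>. finite \<T> \<and> \<Union>\<T> = S \<and>
        (\<forall>T\<in>\<T>. polytope T \<and>
           (\<forall>x\<in>T. \<forall>y\<in>T. \<forall>t\<in>{0..1}.
              f ((1 - t) *\<^sub>R x + t *\<^sub>R y) = (1 - t) *\<^sub>R f x + t *\<^sub>R f y)))"

text \<open>Cells are represented by the closed cells, as subsets of the ambient space.\<close>

record 'a cells =
  cells :: "'a set set"
  cdim  :: "'a set \<Rightarrow> nat"
  chr   :: "'a set \<Rightarrow> (nat \<Rightarrow>\<^sub>0 real) \<Rightarrow> 'a"  \<comment> \<open>characteristic maps\<close>

definition open_cell :: "'a cells \<Rightarrow> 'a set \<Rightarrow> 'a set" where
  "open_cell L \<sigma> = chr L \<sigma> ` (pl_disc (cdim L \<sigma>) - pl_sphere (cdim L \<sigma>))"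

definition cell_boundary :: "'a cells \<Rightarrow> 'a set \<Rightarrow> 'a set" where
  "cell_boundary L \<sigma> = chr L \<sigma> ` pl_sphere (cdim L \<sigma>)"

text \<open>
  A CW complex whose attaching maps (the restrictions of \<open>chr L \<sigma>\<close> to \<open>pl_sphere\<close>) are PL
  embeddings, apart from its global topology, which is treated in \<open>cellulates\<close> below. As the
  attaching maps are embeddings, the complex is regular, and the boundary of each cell is a finite
  union of closed cells of lower dimension; this standard form of closure finiteness is used here.
  The last clause says that the attaching map of \<open>\<sigma>\<close> is PL into the skeleton, i.e. that it is PL in
  the coordinates \<open>chr L \<tau>\<close> of each closed cell \<open>\<tau>\<close> in its image.
\<close>

definition cell_complex :: "'a::topological_space cells \<Rightarrow> bool" where
  "cell_complex L \<longleftrightarrow>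
     (\<forall>\<sigma>\<in>cells L. continuous_on (pl_disc (cdim L \<sigma>)) (chr L \<sigma>) \<and>
        inj_on (chr L \<sigma>) (pl_disc (cdim L \<sigma>)) \<and> chr L \<sigma> ` pl_disc (cdim L \<sigma>) = \<sigma>) \<and>
     (\<forall>\<sigma>\<in>cells L. \<forall>\<tau>\<in>cells L. \<sigma> \<noteq> \<tau> \<longrightarrow> open_cell L \<sigma> \<inter> open_cell L \<tau> = {}) \<and>
     (\<forall>\<sigma>\<in>cells L. finite {\<tau> \<in> cells L. \<tau> \<subseteq> cell_boundary L \<sigma>} \<and>
        cell_boundary L \<sigma> =
          \<Union>{\<tau> \<in> cells L. \<tau> \<subseteq> cell_boundary L \<sigma> \<and> cdim L \<tau> < cdim L \<sigma>}) \<and>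
     (\<forall>\<sigma>\<in>cells L. \<forall>\<tau>\<in>cells L. \<tau> \<subseteq> cell_boundary L \<sigma> \<longrightarrow>
        pl_on {u \<in> pl_sphere (cdim L \<sigma>). chr L \<sigma> u \<in> \<tau>}
              (\<lambda>u. inv_into (pl_disc (cdim L \<tau>)) (chr L \<tau>) (chr L \<sigma> u)))"

text \<open>
  The barycentric subdivision of \<open>L\<close> has the cells of \<open>L\<close> as vertices, the vertex \<open>\<sigma>\<close> being placed
  at the centre \<open>chr L \<sigma> 0\<close>; each closed cell is the cone, with this apex, over its boundary.
  \<open>lam \<sigma> x\<close> is the barycentric coordinate of \<open>x\<close> at the vertex \<open>\<sigma>\<close>. The conditions determine \<open>lam\<close>
  on the union of the cells, by recursion over the dimension of cells.
\<close>

definition barycentric_coords :: "'a cells \<Rightarrow> ('a set \<Rightarrow> 'a \<Rightarrow> real) \<Rightarrow> bool" where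
  "barycentric_coords L lam \<longleftrightarrow>
     (\<forall>\<sigma>\<in>cells L. \<forall>\<tau>\<in>cells L.
        lam \<tau> (chr L \<sigma> 0) = (if \<tau> = \<sigma> then 1 else 0) \<and>
        (\<forall>u\<in>pl_sphere (cdim L \<sigma>). \<forall>t\<in>{0..1}.
           lam \<tau> (chr L \<sigma> (t *\<^sub>R u)) = t * lam \<tau> (chr L \<sigma> u) + (if \<tau> = \<sigma> then 1 - t else 0)))"

definition bary_dist :: "'a cells \<Rightarrow> ('a set \<Rightarrow> 'a \<Rightarrow> real) \<Rightarrow> 'a \<Rightarrow> 'a \<Rightarrow> real" where
  "bary_dist L lam x y =
     (\<Sum>\<sigma> | \<sigma> \<in> cells L \<and> (lam \<sigma> x \<noteq> 0 \<or> lam \<sigma> y \<noteq> 0). \<bar>lam \<sigma> x - lam \<sigma> y\<bar>)"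

text \<open>
  \<open>Y\<close>, as an open subspace of the ambient space, is the underlying space of \<open>L\<close> with the metric
  topology of the barycentric subdivision (which is the weak topology if \<open>L\<close> is locally finite).
\<close>

definition cellulates :: "'a::topological_space cells \<Rightarrow> 'a set \<Rightarrow> bool" where
  "cellulates L Y \<longleftrightarrow> cell_complex L \<and> open Y \<and> \<Union>(cells L) = Y \<and>
     (\<exists>lam. barycentric_coords L lam \<and>
        (\<forall>U\<subseteq>Y. open U \<longleftrightarrow> (\<forall>x\<in>U. \<exists>e>0. \<forall>y\<in>Y. bary_dist L lam x y < e \<longrightarrow> y \<in> U)))"

definition scattered_towards :: "'a::topological_space cells \<Rightarrow> 'a set \<Rightarrow> bool" where
  "scattered_towards L X \<longleftrightarrow>
     (\<forall>\<sigma> y y' x. (\<forall>i::nat. \<sigma> i \<in> cells L \<and> y i \<in> \<sigma> i \<and> y' i \<in> \<sigma> i) \<and> x \<in> X \<and> y \<longlonglongrightarrow> x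
        \<longrightarrow> y' \<longlonglongrightarrow> x)"

text \<open>
  Subcomplexes are represented by their sets of cells; the underlying space of \<open>A\<close> is \<open>\<Union>A\<close>.
\<close>

definition subcomplex :: "'a cells \<Rightarrow> 'a set set \<Rightarrow> bool" where
  "subcomplex L A \<longleftrightarrow> A \<subseteq> cells L \<and> (\<forall>\<sigma>\<in>A. \<forall>\<tau>\<in>cells L. \<tau> \<subseteq> \<sigma> \<longrightarrow> \<tau> \<in> A)"

definition kappa :: "'a::topological_space cells \<Rightarrow> 'a set set set" where
  "kappa L = {K. subcomplex L K \<and> compact (closure (\<Union>K))}"

definition nu :: "'a::topological_space cells \<Rightarrow> 'a set \<Rightarrow> 'a set set set" where
  "nu L X = {N. subcomplex L N \<and> X \<subseteq> interior (\<Union>N \<union> X)}"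

definition nu_bar :: "'a::topological_space cells \<Rightarrow> 'a set set set" where
  "nu_bar L = {F. subcomplex L F \<and> closed (\<Union>F)}"


section \<open>Relative cellular chains and cochains\<close>

definition cell_homology :: "'a::topological_space cells \<Rightarrow> 'a set \<Rightarrow> 'a chain set monoid" where
  "cell_homology L \<sigma> =
     relative_homology_group (int (cdim L \<sigma>)) (top_of_set \<sigma>) (cell_boundary L \<sigma>)"

text \<open>A choice of generators of the infinite cyclic groups \<open>H\<^sub>n(\<sigma>, \<partial>\<sigma>)\<close>.\<close>

definition orientation :: "'a::topological_space cells \<Rightarrow> ('a set \<Rightarrow> 'a chain set) \<Rightarrow> bool" where
  "orientation L ori \<longleftrightarrow>
     (\<forall>\<sigma>\<in>cells L. ori \<sigma> \<in> carrier (cell_homology L \<sigma>) \<and>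
        carrier (subgroup_generated (cell_homology L \<sigma>) {ori \<sigma>}) = carrier (cell_homology L \<sigma>))"

text \<open>
  The incidence number of \<open>\<sigma>\<close> and a cell \<open>\<tau> \<subseteq> \<partial>\<sigma>\<close> with \<open>dim \<sigma> = dim \<tau> + 1 = n + 1\<close>: the image of
  \<open>ori \<sigma>\<close> under \<open>H\<^sub>n\<^sub>+\<^sub>1(\<sigma>, \<partial>\<sigma>) \<rightarrow> H\<^sub>n(\<partial>\<sigma>) \<rightarrow> H\<^sub>n(\<partial>\<sigma>, \<partial>\<sigma> - int \<tau>)\<close> is this multiple of the image of \<open>ori \<tau>\<close>
  under the isomorphism \<open>H\<^sub>n(\<tau>, \<partial>\<tau>) \<rightarrow> H\<^sub>n(\<partial>\<sigma>, \<partial>\<sigma> - int \<tau>)\<close>.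
\<close>

definition incidence ::
  "'a::topological_space cells \<Rightarrow> ('a set \<Rightarrow> 'a chain set) \<Rightarrow> 'a set \<Rightarrow> 'a set \<Rightarrow> int" where
  "incidence L ori \<sigma> \<tau> =
     (let n = int (cdim L \<tau>); S = cell_boundary L \<sigma>; T = S - open_cell L \<tau>;
          H = relative_homology_group n (top_of_set S) T
      in THE k::int.
           hom_induced n (top_of_set S) {} (top_of_set S) T id
             (hom_boundary (n + 1) (top_of_set \<sigma>) S (ori \<sigma>))
           = hom_induced n (top_of_set \<tau>) (cell_boundary L \<tau>) (top_of_set S) T id (ori \<tau>)
               [^]\<^bsub>H\<^esub> k)"

definition cells_of_dim :: "'a cells \<Rightarrow> nat \<Rightarrow> 'a set set \<Rightarrow> 'a set set" where
  "cells_of_dim L n A = {\<sigma> \<in> A. cdim L \<sigma> = n}"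

text \<open>
  The coefficient group \<open>G\<close> is written multiplicatively, as always in HOL-Algebra. The boundary and
  coboundary maps are given for (co)chains on sets \<open>S'\<close> of \<open>(n + 1)\<close>-cells and \<open>S\<close> of \<open>n\<close>-cells.
\<close>

definition boundary_map ::
  "'a::topological_space cells \<Rightarrow> ('a set \<Rightarrow> 'a chain set) \<Rightarrow> 'g monoid \<Rightarrow> 'a set set \<Rightarrow> 'a set set
     \<Rightarrow> ('a set \<Rightarrow> 'g) \<Rightarrow> 'a set \<Rightarrow> 'g" where
  "boundary_map L ori G S' S g =
     (\<lambda>\<tau>\<in>S. finprod G (\<lambda>\<sigma>. g \<sigma> [^]\<^bsub>G\<^esub> incidence L ori \<sigma> \<tau>)
               {\<sigma> \<in> S'. \<tau> \<subseteq> cell_boundary L \<sigma> \<and> g \<sigma> \<noteq> \<one>\<^bsub>G\<^esub>})"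

definition coboundary_map ::
  "'a::topological_space cells \<Rightarrow> ('a set \<Rightarrow> 'a chain set) \<Rightarrow> 'g monoid \<Rightarrow> 'a set set \<Rightarrow> 'a set set
     \<Rightarrow> ('a set \<Rightarrow> 'g) \<Rightarrow> 'a set \<Rightarrow> 'g" where
  "coboundary_map L ori G S S' g =
     (\<lambda>\<sigma>\<in>S'. finprod G (\<lambda>\<tau>. g \<tau> [^]\<^bsub>G\<^esub> incidence L ori \<sigma> \<tau>)
               {\<tau> \<in> S. \<tau> \<subseteq> cell_boundary L \<sigma>})"

text \<open>
  \<open>C\<^sub>n(A, B)\<close> and \<open>C\<^sup>n(A, B)\<close> for subcomplexes \<open>B \<subseteq> A\<close>. The maps induced by an inclusion
  \<open>(A, B) \<subseteq> (A', B')\<close>, in either variance, restrict a (co)chain to the cells of the target that are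
  present in the source and extend it trivially to the other cells of the target.
\<close>

definition rel_chains ::
  "'a cells \<Rightarrow> 'g monoid \<Rightarrow> nat \<Rightarrow> 'a set set \<Rightarrow> 'a set set \<Rightarrow> ('a set \<Rightarrow> 'g) monoid" where
  "rel_chains L G n A B = sum_group (cells_of_dim L n (A - B)) (\<lambda>_. G)"

definition rel_cochains ::
  "'a cells \<Rightarrow> 'g monoid \<Rightarrow> nat \<Rightarrow> 'a set set \<Rightarrow> 'a set set \<Rightarrow> ('a set \<Rightarrow> 'g) monoid" where
  "rel_cochains L G n A B = product_group (cells_of_dim L n (A - B)) (\<lambda>_. G)"

definition rel_boundary where
  "rel_boundary L ori G n A B =
     boundary_map L ori G (cells_of_dim L (Suc n) (A - B)) (cells_of_dim L n (A - B))"

definition rel_coboundary where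
  "rel_coboundary L ori G n A B =
     coboundary_map L ori G (cells_of_dim L n (A - B)) (cells_of_dim L (Suc n) (A - B))"

definition induced_map ::
  "'a cells \<Rightarrow> 'g monoid \<Rightarrow> nat \<Rightarrow> 'a set set \<times> 'a set set \<Rightarrow> 'a set set \<times> 'a set set
     \<Rightarrow> ('a set \<Rightarrow> 'g) \<Rightarrow> 'a set \<Rightarrow> 'g" where
  "induced_map L G n = (\<lambda>(A, B) (A', B') g.
     \<lambda>\<sigma>\<in>cells_of_dim L n (A' - B').
       if \<sigma> \<in> cells_of_dim L n (A - B) then g \<sigma> else \<one>\<^bsub>G\<^esub>)"


section \<open>The groups with supports in \<open>\<kappa>\<close> and \<open>\<nu>\<close>\<close>

definition supp :: "'g monoid \<Rightarrow> 'c set \<Rightarrow> ('c \<Rightarrow> 'g) \<Rightarrow> 'c set" where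
  "supp G S g = {\<sigma> \<in> S. g \<sigma> \<noteq> \<one>\<^bsub>G\<^esub>}"

definition all_chains :: "'a cells \<Rightarrow> 'g monoid \<Rightarrow> 'a set set \<Rightarrow> nat \<Rightarrow> ('a set \<Rightarrow> 'g) monoid" where
  "all_chains L G P n = product_group (cells_of_dim L n P) (\<lambda>_. G)"

definition chains_kappa where
  "chains_kappa L G P n =
     {g \<in> carrier (all_chains L G P n). \<exists>K\<in>kappa L. supp G (cells_of_dim L n P) g \<subseteq> K}"

definition cochains_kappa where
  "cochains_kappa L G P n =
     {g \<in> carrier (all_chains L G P n). \<forall>K\<in>kappa L. finite (supp G (cells_of_dim L n P) g \<inter> K)}"

definition chains_nu where
  "chains_nu L G P n =
     {g \<in> carrier (all_chains L G P n). \<forall>F\<in>nu_bar L. finite (supp G (cells_of_dim L n P) g \<inter> F)}"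

definition cochains_nu where
  "cochains_nu L G P n =
     {g \<in> carrier (all_chains L G P n). \<exists>F\<in>nu_bar L. supp G (cells_of_dim L n P) g \<subseteq> F}"

definition subgroup_of_chains where
  "subgroup_of_chains L G P n C = (all_chains L G P n)\<lparr>carrier := C\<rparr>"


section \<open>Limits, colimits, and their interchange\<close>

text \<open>
  A direct system over a set \<open>I\<close> directed by \<open>leq\<close> has groups \<open>A i\<close> and maps \<open>u i k : A i \<rightarrow> A k\<close> for
  \<open>leq i k\<close>; an inverse system over \<open>J\<close> has maps \<open>v j k : A k \<rightarrow> A j\<close> for \<open>leq j k\<close>.
\<close>

definition colim_rel ::
  "'i set \<Rightarrow> ('i \<Rightarrow> 'i \<Rightarrow> bool) \<Rightarrow> ('i \<Rightarrow> 'c monoid) \<Rightarrow> ('i \<Rightarrow> 'i \<Rightarrow> 'c \<Rightarrow> 'c)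
     \<Rightarrow> (('i \<times> 'c) \<times> ('i \<times> 'c)) set" where
  "colim_rel I leq A u =
     {((i, x), (j, y)) | i x j y.
        i \<in> I \<and> x \<in> carrier (A i) \<and> j \<in> I \<and> y \<in> carrier (A j) \<and>
        (\<exists>k\<in>I. leq i k \<and> leq j k \<and> u i k x = u j k y)}"

definition colim_class where
  "colim_class I leq A u i x = colim_rel I leq A u `` {(i, x)}"

text \<open>
  Unions over all representatives serve below to define maps on equivalence classes.
\<close>

definition colim ::
  "'i set \<Rightarrow> ('i \<Rightarrow> 'i \<Rightarrow> bool) \<Rightarrow> ('i \<Rightarrow> 'c monoid) \<Rightarrow> ('i \<Rightarrow> 'i \<Rightarrow> 'c \<Rightarrow> 'c)
     \<Rightarrow> ('i \<times> 'c) set monoid" where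
  "colim I leq A u =
     \<lparr>carrier = (SIGMA i:I. carrier (A i)) // colim_rel I leq A u,
      monoid.mult = (\<lambda>c d. \<Union>{colim_class I leq A u k (u i k x \<otimes>\<^bsub>A k\<^esub> u j k y) | i x j y k.
                                (i, x) \<in> c \<and> (j, y) \<in> d \<and> k \<in> I \<and> leq i k \<and> leq j k}),
      one = (\<Union>i\<in>I. colim_class I leq A u i \<one>\<^bsub>A i\<^esub>)\<rparr>"

text \<open>The map into the colimit of \<open>(B, u)\<close> induced by maps \<open>f i\<close> into \<open>B i\<close>.\<close>

definition colim_map where
  "colim_map I leq B u f c = \<Union>{colim_class I leq B u i (f i x) | i x. (i, x) \<in> c}"

definition lim_group ::
  "'j set \<Rightarrow> ('j \<Rightarrow> 'j \<Rightarrow> bool) \<Rightarrow> ('j \<Rightarrow> 'c monoid) \<Rightarrow> ('j \<Rightarrow> 'j \<Rightarrow> 'c \<Rightarrow> 'c)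
     \<Rightarrow> ('j \<Rightarrow> 'c) monoid" where
  "lim_group J leq A v =
     (product_group J A)
       \<lparr>carrier := {x \<in> carrier (product_group J A).
                      \<forall>j\<in>J. \<forall>k\<in>J. leq j k \<longrightarrow> v j k (x k) = x j}\<rparr>"

definition lim_map where
  "lim_map J f x = (\<lambda>j\<in>J. f j (x j))"

text \<open>
  For groups \<open>F i j\<close> forming direct systems in \<open>i\<close> with maps \<open>u i k j : F i j \<rightarrow> F k j\<close> and inverse
  systems in \<open>j\<close> with maps \<open>v i j k : F i k \<rightarrow> F i j\<close>: the groups \<open>colim\<^sub>i lim\<^sub>j F i j\<close> and
  \<open>lim\<^sub>j colim\<^sub>i F i j\<close>, the maps into them induced by maps \<open>f i j\<close> into \<open>F i j\<close>, and the natural map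
  from the former group to the latter.
\<close>

definition colim_lim where
  "colim_lim I leI J leJ F u v =
     colim I leI (\<lambda>i. lim_group J leJ (F i) (v i)) (\<lambda>i k. lim_map J (u i k))"

definition colim_lim_map where
  "colim_lim_map I leI J leJ F u v f =
     colim_map I leI (\<lambda>i. lim_group J leJ (F i) (v i)) (\<lambda>i k. lim_map J (u i k))
       (\<lambda>i. lim_map J (f i))"

definition lim_colim where
  "lim_colim I leI J leJ F u v =
     lim_group J leJ (\<lambda>j. colim I leI (\<lambda>i. F i j) (\<lambda>i k. u i k j))
       (\<lambda>j k. colim_map I leI (\<lambda>i. F i j) (\<lambda>i k. u i k j) (\<lambda>i. v i j k))"

definition lim_colim_map where
  "lim_colim_map I leI J F u f =
     lim_map J (\<lambda>j. colim_map I leI (\<lambda>i. F i j) (\<lambda>i k. u i k j) (\<lambda>i. f i j))"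

definition interchange where
  "interchange I leI J F u c =
     (\<lambda>j\<in>J. colim_map I leI (\<lambda>i. F i j) (\<lambda>i k. u i k j) (\<lambda>i x. x j) c)"

text \<open>
  Isomorphisms of (co)chain complexes of abelian groups, concentrated in degrees \<open>n \<ge> 0\<close>.
\<close>

definition chain_complex_iso ::
  "(nat \<Rightarrow> 'c monoid) \<Rightarrow> (nat \<Rightarrow> 'c \<Rightarrow> 'c) \<Rightarrow> (nat \<Rightarrow> 'd monoid) \<Rightarrow> (nat \<Rightarrow> 'd \<Rightarrow> 'd)
     \<Rightarrow> (nat \<Rightarrow> 'c \<Rightarrow> 'd) \<Rightarrow> bool" where
  "chain_complex_iso C d D e \<phi> \<longleftrightarrow>
     (\<forall>n. comm_group (C n) \<and> comm_group (D n) \<and>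
          d n \<in> hom (C (Suc n)) (C n) \<and> e n \<in> hom (D (Suc n)) (D n) \<and>
          \<phi> n \<in> iso (C n) (D n) \<and>
          (\<forall>x\<in>carrier (C (Suc n)). \<phi> n (d n x) = e n (\<phi> (Suc n) x)))"

definition cochain_complex_iso ::
  "(nat \<Rightarrow> 'c monoid) \<Rightarrow> (nat \<Rightarrow> 'c \<Rightarrow> 'c) \<Rightarrow> (nat \<Rightarrow> 'd monoid) \<Rightarrow> (nat \<Rightarrow> 'd \<Rightarrow> 'd)
     \<Rightarrow> (nat \<Rightarrow> 'c \<Rightarrow> 'd) \<Rightarrow> bool" where
  "cochain_complex_iso C d D e \<phi> \<longleftrightarrow>
     (\<forall>n. comm_group (C n) \<and> comm_group (D n) \<and>
          d n \<in> hom (C n) (C (Suc n)) \<and> e n \<in> hom (D n) (D (Suc n)) \<and>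
          \<phi> n \<in> iso (C n) (D n) \<and>
          (\<forall>x\<in>carrier (C n). \<phi> (Suc n) (d n x) = e n (\<phi> n x)))"


section \<open>The double systems \<open>C(P \<inter> K, P \<inter> K \<inter> N)\<close>\<close>

text \<open>
  Chains: direct in \<open>K\<close>, inverse in \<open>N\<close>. Cochains: direct in \<open>N\<close>, inverse in \<open>K\<close>.
  Here \<open>\<kappa>\<close> is directed by inclusion and \<open>\<nu>\<close> by reverse inclusion.
\<close>

definition ch :: "'a cells \<Rightarrow> 'g monoid \<Rightarrow> 'a set set \<Rightarrow> nat
    \<Rightarrow> 'a set set \<Rightarrow> 'a set set \<Rightarrow> ('a set \<Rightarrow> 'g) monoid" where
  "ch L G P n K N = rel_chains L G n (P \<inter> K) (P \<inter> K \<inter> N)"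

definition ch_d where
  "ch_d L ori G P n K N = rel_boundary L ori G n (P \<inter> K) (P \<inter> K \<inter> N)"

definition ch_K where
  "ch_K L G P n K K' N = induced_map L G n (P \<inter> K, P \<inter> K \<inter> N) (P \<inter> K', P \<inter> K' \<inter> N)"

definition ch_N where
  "ch_N L G P n K N N' = induced_map L G n (P \<inter> K, P \<inter> K \<inter> N') (P \<inter> K, P \<inter> K \<inter> N)"

definition coch :: "'a cells \<Rightarrow> 'g monoid \<Rightarrow> 'a set set \<Rightarrow> nat
    \<Rightarrow> 'a set set \<Rightarrow> 'a set set \<Rightarrow> ('a set \<Rightarrow> 'g) monoid" where
  "coch L G P n N K = rel_cochains L G n (P \<inter> K) (P \<inter> K \<inter> N)"

definition coch_d where
  "coch_d L ori G P n N K = rel_coboundary L ori G n (P \<inter> K) (P \<inter> K \<inter> N)"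

definition coch_N where
  "coch_N L G P n N N' K = induced_map L G n (P \<inter> K, P \<inter> K \<inter> N) (P \<inter> K, P \<inter> K \<inter> N')"

definition coch_K where
  "coch_K L G P n N K K' = induced_map L G n (P \<inter> K', P \<inter> K' \<inter> N) (P \<inter> K, P \<inter> K \<inter> N)"

definition chain_colim_lim where
  "chain_colim_lim L X G P n =
     colim_lim (kappa L) (\<subseteq>) (nu L X) (\<supseteq>) (ch L G P n) (ch_K L G P n) (ch_N L G P n)"

definition chain_colim_lim_d where
  "chain_colim_lim_d L X ori G P n =
     colim_lim_map (kappa L) (\<subseteq>) (nu L X) (\<supseteq>) (ch L G P n) (ch_K L G P n) (ch_N L G P n)
       (ch_d L ori G P n)"

definition chain_lim_colim where
  "chain_lim_colim L X G P n =
     lim_colim (kappa L) (\<subseteq>) (nu L X) (\<supseteq>) (ch L G P n) (ch_K L G P n) (ch_N L G P n)"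

definition chain_lim_colim_d where
  "chain_lim_colim_d L X ori G P n =
     lim_colim_map (kappa L) (\<subseteq>) (nu L X) (ch L G P n) (ch_K L G P n) (ch_d L ori G P n)"

definition chain_interchange where
  "chain_interchange L X G P n =
     interchange (kappa L) (\<subseteq>) (nu L X) (ch L G P n) (ch_K L G P n)"

definition cochain_colim_lim where
  "cochain_colim_lim L X G P n =
     colim_lim (nu L X) (\<supseteq>) (kappa L) (\<subseteq>) (coch L G P n) (coch_N L G P n) (coch_K L G P n)"

definition cochain_colim_lim_d where
  "cochain_colim_lim_d L X ori G P n =
     colim_lim_map (nu L X) (\<supseteq>) (kappa L) (\<subseteq>)
       (coch L G P (Suc n)) (coch_N L G P (Suc n)) (coch_K L G P (Suc n)) (coch_d L ori G P n)"

definition cochain_lim_colim where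
  "cochain_lim_colim L X G P n =
     lim_colim (nu L X) (\<supseteq>) (kappa L) (\<subseteq>) (coch L G P n) (coch_N L G P n) (coch_K L G P n)"

definition cochain_lim_colim_d where
  "cochain_lim_colim_d L X ori G P n =
     lim_colim_map (nu L X) (\<supseteq>) (kappa L)
       (coch L G P (Suc n)) (coch_N L G P (Suc n)) (coch_d L ori G P n)"

definition cochain_interchange where
  "cochain_interchange L X G P n =
     interchange (nu L X) (\<supseteq>) (kappa L) (coch L G P n) (coch_N L G P n)"

text \<open>The (co)boundary maps of the complexes of (co)chains on \<open>P\<close> with supports.\<close>

definition supp_boundary where
  "supp_boundary L ori G P n =
     boundary_map L ori G (cells_of_dim L (Suc n) P) (cells_of_dim L n P)"

definition supp_coboundary where
  "supp_coboundary L ori G P n =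
     coboundary_map L ori G (cells_of_dim L n P) (cells_of_dim L (Suc n) P)"

end

theory Submission
  imports Defs
begin

text \<open>
  Scatteredness makes \<open>\<kappa>\<close> and \<open>\<nu>\<close> dual to each other. A set of cells which is relatively compact and
  has no limit points in \<open>X\<close> is finite, since the barycentres of its cells are discrete; so every
  \<open>K - N\<close> with \<open>K \<in> \<kappa>\<close>, \<open>N \<in> \<nu>\<close> is finite. Conversely, cells having points that converge to some
  \<open>x \<in> X\<close> converge to \<open>x\<close> themselves. Hence a set of cells meeting every \<open>K\<close> in a finite set misses some
  \<open>N\<close>, and a set having only finitely many cells outside each \<open>N\<close> lies in some \<open>K\<close>.

  The groups \<open>C(P \<inter> K, P \<inter> K \<inter> N)\<close> are then finite powers of \<open>G\<close> indexed by \<open>(P \<inter> K) \<inter> (P - N)\<close>, and the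
  interchange map amounts to the inclusion of the group of (co)chains whose support lies in a single
  set \<open>D i\<close> of the direct index into the group of those whose support has this property within each
  set \<open>E j\<close> of the inverse index. The two statements above say that these groups agree.
\<close>

section \<open>The topology of scattered cell complexes\<close>

text \<open>The complex need not be locally finite: one vertex may lie on infinitely many edges, so
  a compact set missing \<open>X\<close> can meet infinitely many cells. Finiteness has to be drawn
  from whole cells, and the barycentre is the point that recognises its cell: its coordinate there
  is 1, while every other barycentre has coordinate 0 there. The metric topology enters through the
  estimate that the change of a single coordinate is at most \<open>bary_dist\<close>; this makes
  sets of barycentres, and underlying spaces of subcomplexes, closed relative to the complement of
  \<open>X\<close>. What remains happens at points of \<open>X\<close>, where scatteredness turns
  convergence of points into convergence of entire cells.

  On the algebraic side, colimits and limits do not commute in general, because a compatible family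
  of classes may need a different index for each \<open>j\<close>. Here the obstruction is a
  covering condition on supports, isolated as the hypothesis of \<open>interchange_iso\<close>; the
  topological duality is what verifies it.\<close>

lemma lookup_scaleR: "Poly_Mapping.lookup (r *\<^sub>R x) i = r *\<^sub>R Poly_Mapping.lookup x i"
proof -
  have "finite {i. r *\<^sub>R Poly_Mapping.lookup x i \<noteq> 0}"
    by (rule finite_subset[OF _ finite_lookup[of x]]) auto
  then show ?thesis by (simp add: scaleR_poly_mapping_def)
qed

text \<open>The ambient space is infinite-dimensional, so closed bounded sets need not be compact. A
  cube, unlike the cross-polytope, splits off one coordinate as a factor, which allows an induction
  in which it is the continuous image of a product.\<close>

lemma compact_cube_poly_mapping:
  "compact {x :: nat \<Rightarrow>\<^sub>0 real. Poly_Mapping.keys x \<subseteq> {..<n} \<and> (\<forall>i. \<bar>Poly_Mapping.lookup x i\<bar> \<le> 1)}"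
  (is "compact (?C n)")
proof (induction n)
  case 0
  have "?C 0 = {0}" by auto
  then show ?case by simp
next
  case (Suc n)
  let ?e = "Poly_Mapping.single n (1::real)"
  have "?C (Suc n) = (\<lambda>(x, t). x + t *\<^sub>R ?e) ` (?C n \<times> {-1..1})"
  proof (intro subset_antisym subsetI)
    fix x assume x: "x \<in> ?C (Suc n)"
    define y where "y = x - Poly_Mapping.lookup x n *\<^sub>R ?e"
    have ly: "Poly_Mapping.lookup y i = (if i = n then 0 else Poly_Mapping.lookup x i)" for i
      by (simp add: y_def lookup_minus lookup_single lookup_scaleR when_def)
    have "y \<in> ?C n"
      using x by (auto simp: ly in_keys_iff subset_iff less_Suc_eq)
    moreover have "Poly_Mapping.lookup x n \<in> {-1..1}"
      using x by (auto simp: abs_le_iff)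
    moreover have "x = y + Poly_Mapping.lookup x n *\<^sub>R ?e" by (simp add: y_def)
    ultimately show "x \<in> (\<lambda>(x, t). x + t *\<^sub>R ?e) ` (?C n \<times> {-1..1})"
      by force
  next
    fix z assume "z \<in> (\<lambda>(x, t). x + t *\<^sub>R ?e) ` (?C n \<times> {-1..1})"
    then obtain x t where x: "x \<in> ?C n" and t: "\<bar>t\<bar> \<le> 1" and z: "z = x + t *\<^sub>R ?e"
      by (auto simp: abs_le_iff)
    have "Poly_Mapping.lookup x n = 0"
      using x by (auto simp: in_keys_iff subset_iff)
    then have lz: "Poly_Mapping.lookup z i = (if i = n then t else Poly_Mapping.lookup x i)" for i
      by (auto simp: z lookup_add lookup_single lookup_scaleR when_def)
    show "z \<in> ?C (Suc n)"
      using x t by (auto simp: lz in_keys_iff subset_iff less_Suc_eq)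
  qed
  moreover have "compact ((\<lambda>(x, t). x + t *\<^sub>R ?e) ` (?C n \<times> {-1..1}))"
    using Suc by (intro compact_continuous_image compact_Times)
      (auto simp: case_prod_beta intro!: continuous_intros)
  ultimately show ?case by simp
qed

lemma abs_lookup_le_norm: "\<bar>Poly_Mapping.lookup x i\<bar> \<le> norm (x :: 'a \<Rightarrow>\<^sub>0 real)"
proof (cases "i \<in> Poly_Mapping.keys x")
  case True
  then show ?thesis
    by (auto simp: norm_poly_mapping_def dist_poly_mapping_def intro!: member_le_sum)
qed (auto simp: in_keys_iff)

text \<open>Each coordinate is bounded by the l1-norm, so the cross-polytope is the part of the cube
  inside the closed unit ball.\<close>

lemma compact_pl_disc: "compact (pl_disc n)"
proof -
  have "pl_disc n = {x. Poly_Mapping.keys x \<subseteq> {..<n} \<and> (\<forall>i. \<bar>Poly_Mapping.lookup x i\<bar> \<le> 1)} \<inter> cball 0 1"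
    using abs_lookup_le_norm[THEN order_trans] by (auto simp: pl_disc_def)
  then show ?thesis
    by (simp add: compact_cube_poly_mapping compact_Int_closed)
qed

lemma zero_in_pl_disc: "0 \<in> pl_disc n"
  by (simp add: pl_disc_def)

lemma pl_sphere_subset_disc: "pl_sphere n \<subseteq> pl_disc n"
  by (auto simp: pl_sphere_def pl_disc_def)

lemma pl_disc_polar:
  assumes "v \<in> pl_disc n" "v \<noteq> 0"
  obtains u where "u \<in> pl_sphere n" "v = norm v *\<^sub>R u"
proof
  have "Poly_Mapping.keys ((1 / norm v) *\<^sub>R v) \<subseteq> Poly_Mapping.keys v"
    by (auto simp: in_keys_iff lookup_scaleR)
  then show "(1 / norm v) *\<^sub>R v \<in> pl_sphere n"
    using assms by (auto simp: pl_sphere_def pl_disc_def)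
  show "v = norm v *\<^sub>R ((1 / norm v) *\<^sub>R v)" using assms by simp
qed

section \<open>Barycentric coordinates of a cell complex\<close>

locale barycentric_complex =
  fixes L :: "'a::topological_space cells" and lam :: "'a set \<Rightarrow> 'a \<Rightarrow> real"
  assumes complex: "cell_complex L" and coords: "barycentric_coords L lam"
begin

lemma continuous_on_chr: "\<sigma> \<in> cells L \<Longrightarrow> continuous_on (pl_disc (cdim L \<sigma>)) (chr L \<sigma>)"
  and inj_on_chr: "\<sigma> \<in> cells L \<Longrightarrow> inj_on (chr L \<sigma>) (pl_disc (cdim L \<sigma>))"
  and image_chr: "\<sigma> \<in> cells L \<Longrightarrow> chr L \<sigma> ` pl_disc (cdim L \<sigma>) = \<sigma>"
  and finite_faces: "\<sigma> \<in> cells L \<Longrightarrow> finite {\<tau> \<in> cells L. \<tau> \<subseteq> cell_boundary L \<sigma>}"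
  using complex by (simp_all add: cell_complex_def)

lemma cell_boundary_cell:
  assumes "\<sigma> \<in> cells L" "y \<in> cell_boundary L \<sigma>"
  obtains \<tau> where "\<tau> \<in> cells L" "\<tau> \<subseteq> cell_boundary L \<sigma>" "cdim L \<tau> < cdim L \<sigma>" "y \<in> \<tau>"
proof -
  have "cell_boundary L \<sigma> =
      \<Union>{\<tau> \<in> cells L. \<tau> \<subseteq> cell_boundary L \<sigma> \<and> cdim L \<tau> < cdim L \<sigma>}"
    using complex assms(1) unfolding cell_complex_def by blast
  with assms(2) have "y \<in> \<Union>{\<tau> \<in> cells L. \<tau> \<subseteq> cell_boundary L \<sigma> \<and> cdim L \<tau> < cdim L \<sigma>}"
    by simp
  then show thesis using that by blast
qed

lemma compact_cell: "\<sigma> \<in> cells L \<Longrightarrow> compact \<sigma>"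
  by (metis compact_continuous_image compact_pl_disc continuous_on_chr image_chr)

lemma cell_boundary_subset: "\<sigma> \<in> cells L \<Longrightarrow> cell_boundary L \<sigma> \<subseteq> \<sigma>"
  unfolding cell_boundary_def using image_chr pl_sphere_subset_disc by blast

lemma barycenter_in_cell: "\<sigma> \<in> cells L \<Longrightarrow> chr L \<sigma> 0 \<in> \<sigma>"
  using image_chr zero_in_pl_disc by blast

lemma barycenter_notin_boundary:
  assumes "\<sigma> \<in> cells L" shows "chr L \<sigma> 0 \<notin> cell_boundary L \<sigma>"
proof
  assume "chr L \<sigma> 0 \<in> cell_boundary L \<sigma>"
  then obtain u where "u \<in> pl_sphere (cdim L \<sigma>)" "chr L \<sigma> u = chr L \<sigma> 0"
    by (auto simp: cell_boundary_def)
  with inj_on_chr[OF assms] have "u = 0"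
    using inj_onD pl_sphere_subset_disc zero_in_pl_disc by fastforce
  with \<open>u \<in> pl_sphere (cdim L \<sigma>)\<close> show False by (simp add: pl_sphere_def)
qed

lemma lam_barycenter:
  "\<sigma> \<in> cells L \<Longrightarrow> \<tau> \<in> cells L \<Longrightarrow> lam \<tau> (chr L \<sigma> 0) = (if \<tau> = \<sigma> then 1 else 0)"
  using coords by (simp add: barycentric_coords_def)

lemma lam_cone:
  assumes "\<sigma> \<in> cells L" "\<tau> \<in> cells L" "u \<in> pl_sphere (cdim L \<sigma>)" "0 \<le> t" "t \<le> 1"
  shows "lam \<tau> (chr L \<sigma> (t *\<^sub>R u)) = t * lam \<tau> (chr L \<sigma> u) + (if \<tau> = \<sigma> then 1 - t else 0)"
  using coords assms by (simp add: barycentric_coords_def)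

text \<open>Projecting \<open>y\<close> radially from the centre of \<open>\<tau>\<close> to the
  boundary rescales all coordinates except the one at \<open>\<tau>\<close>. A nonzero coordinate at
  another cell therefore persists at a boundary point, which lies in a cell of smaller dimension,
  and induction applies.\<close>

lemma lam_support:
  assumes "\<tau> \<in> cells L" "\<sigma> \<in> cells L" "y \<in> \<tau>" "lam \<sigma> y \<noteq> 0"
  shows "\<sigma> = \<tau> \<or> \<sigma> \<subseteq> cell_boundary L \<tau>"
  using assms
proof (induction "cdim L \<tau>" arbitrary: \<tau> y rule: less_induct)
  case less
  from less.prems obtain v where v: "v \<in> pl_disc (cdim L \<tau>)" "y = chr L \<tau> v"
    using image_chr by blast
  show ?case
  proof (cases "\<sigma> = \<tau>")
    case False
    then have "v \<noteq> 0" using less.prems v lam_barycenter[of \<tau> \<sigma>] by auto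
    with v obtain u where u: "u \<in> pl_sphere (cdim L \<tau>)" "v = norm v *\<^sub>R u"
      by (blast elim: pl_disc_polar)
    have "norm v \<le> 1" using v by (simp add: pl_disc_def)
    then have "lam \<sigma> y = norm v * lam \<sigma> (chr L \<tau> u)"
      using lam_cone[OF less.prems(1,2) u(1), of "norm v"] v(2) u(2) False by simp
    then have nz: "lam \<sigma> (chr L \<tau> u) \<noteq> 0" using less.prems(4) by auto
    have "chr L \<tau> u \<in> cell_boundary L \<tau>" using u by (simp add: cell_boundary_def)
    then obtain \<rho> where \<rho>: "\<rho> \<in> cells L" "\<rho> \<subseteq> cell_boundary L \<tau>" "cdim L \<rho> < cdim L \<tau>"
        "chr L \<tau> u \<in> \<rho>"
      using cell_boundary_cell less.prems(1) by blast
    then have "\<sigma> = \<rho> \<or> \<sigma> \<subseteq> cell_boundary L \<rho>"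
      using less.hyps less.prems(2) nz by blast
    then show ?thesis using \<rho> cell_boundary_subset by blast
  qed simp
qed

lemma lam_support_subset:
  "\<tau> \<in> cells L \<Longrightarrow> \<sigma> \<in> cells L \<Longrightarrow> y \<in> \<tau> \<Longrightarrow> lam \<sigma> y \<noteq> 0 \<Longrightarrow> \<sigma> \<subseteq> \<tau>"
  using lam_support cell_boundary_subset by blast

lemma finite_lam_support:
  assumes "y \<in> \<Union>(cells L)" shows "finite {\<sigma> \<in> cells L. lam \<sigma> y \<noteq> 0}"
proof -
  from assms obtain \<tau> where \<tau>: "\<tau> \<in> cells L" "y \<in> \<tau>" by blast
  have "{\<sigma> \<in> cells L. lam \<sigma> y \<noteq> 0} \<subseteq> insert \<tau> {\<sigma> \<in> cells L. \<sigma> \<subseteq> cell_boundary L \<tau>}"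
    using lam_support \<tau> by blast
  then show ?thesis
    using finite_faces[OF \<tau>(1)] finite_subset by blast
qed

text \<open>The sum defining \<open>bary_dist\<close> dominates each of its terms because it is a
  finite sum; over an infinite index set the formal sum would be 0.\<close>

lemma lam_diff_le_bary_dist:
  assumes "x \<in> \<Union>(cells L)" "y \<in> \<Union>(cells L)" "\<sigma> \<in> cells L"
  shows "\<bar>lam \<sigma> x - lam \<sigma> y\<bar> \<le> bary_dist L lam x y"
proof (cases "lam \<sigma> x = 0 \<and> lam \<sigma> y = 0")
  case True
  then show ?thesis by (simp add: bary_dist_def sum_nonneg)
next
  case False
  have "{\<sigma> \<in> cells L. lam \<sigma> x \<noteq> 0 \<or> lam \<sigma> y \<noteq> 0} =
      {\<sigma> \<in> cells L. lam \<sigma> x \<noteq> 0} \<union> {\<sigma> \<in> cells L. lam \<sigma> y \<noteq> 0}" by blast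
  then have "finite {\<sigma> \<in> cells L. lam \<sigma> x \<noteq> 0 \<or> lam \<sigma> y \<noteq> 0}"
    using finite_lam_support assms by simp
  then show ?thesis
    unfolding bary_dist_def using False assms(3)
    by (intro member_le_sum[where f = "\<lambda>\<sigma>. \<bar>lam \<sigma> x - lam \<sigma> y\<bar>"]) auto
qed

text \<open>A cell of least dimension containing \<open>y\<close> has \<open>y\<close> in its
  interior, since a boundary point would lie in a cell of smaller dimension. If \<open>v\<close> is
  the parameter of \<open>y\<close> in the disc, the coordinate at this cell is
  \<open>1 - norm v\<close>: positive, and equal to 1 only at the centre.\<close>

lemma carrier_cell:
  assumes "y \<in> \<Union>(cells L)"
  obtains \<tau> where "\<tau> \<in> cells L" "y \<in> \<tau>" "0 < lam \<tau> y" "lam \<tau> y = 1 \<longrightarrow> y = chr L \<tau> 0"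
proof -
  obtain \<tau> where \<tau>: "\<tau> \<in> cells L" "y \<in> \<tau>"
    and min: "\<And>\<rho>. \<rho> \<in> cells L \<Longrightarrow> y \<in> \<rho> \<Longrightarrow> cdim L \<tau> \<le> cdim L \<rho>"
    using exists_least_iff[of "\<lambda>n. \<exists>\<tau>\<in>cells L. y \<in> \<tau> \<and> cdim L \<tau> = n"] assms
    by (metis Union_iff linorder_not_less)
  obtain v where v: "v \<in> pl_disc (cdim L \<tau>)" "y = chr L \<tau> v"
    using \<tau> image_chr by blast
  have bd: "y \<notin> cell_boundary L \<tau>"
    using min \<tau> cell_boundary_cell[of \<tau> y] by (metis linorder_not_less)
  then have "v \<notin> pl_sphere (cdim L \<tau>)" using v by (auto simp: cell_boundary_def)
  then have v1: "norm v < 1" using v by (auto simp: pl_disc_def pl_sphere_def)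
  have lam: "lam \<tau> y = 1 - norm v"
  proof (cases "v = 0")
    case True
    then show ?thesis using v \<tau> lam_barycenter by simp
  next
    case False
    with v obtain u where u: "u \<in> pl_sphere (cdim L \<tau>)" "v = norm v *\<^sub>R u"
      by (blast elim: pl_disc_polar)
    have "lam \<tau> (chr L \<tau> u) = 0"
    \<comment> \<open>The projected point lies in some cell \<open>\<rho>\<close> of the boundary. A
      nonzero coordinate at \<open>\<tau>\<close> would place \<open>\<tau>\<close> inside
      \<open>\<rho>\<close>, hence the centre of \<open>\<tau>\<close> on its own boundary.\<close>
    proof (rule ccontr)
      assume nz: "lam \<tau> (chr L \<tau> u) \<noteq> 0"
      have "chr L \<tau> u \<in> cell_boundary L \<tau>" using u by (simp add: cell_boundary_def)
      then obtain \<rho> where \<rho>: "\<rho> \<in> cells L" "\<rho> \<subseteq> cell_boundary L \<tau>" "chr L \<tau> u \<in> \<rho>"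
        using cell_boundary_cell \<tau>(1) by blast
      then have "\<tau> \<subseteq> \<rho>" using lam_support_subset nz \<tau> by blast
      then show False
        using \<rho> barycenter_in_cell barycenter_notin_boundary \<tau>(1) by blast
    qed
    then show ?thesis
      using lam_cone[OF \<tau>(1) \<tau>(1) u(1), of "norm v"] u(2) v(2) v1 by simp
  qed
  with v1 \<tau> v show thesis by (intro that[of \<tau>]) auto
qed

text \<open>The barycentre of \<open>\<sigma>\<close> detects membership: any cell containing it has
  nonzero coordinate at \<open>\<sigma>\<close> there, hence contains all of
  \<open>\<sigma>\<close>.\<close>

lemma subset_cells_Union_iff:
  assumes "subcomplex L N" "\<sigma> \<in> cells L"
  shows "\<sigma> \<subseteq> \<Union>N \<longleftrightarrow> \<sigma> \<in> N"
proof
  assume "\<sigma> \<subseteq> \<Union>N"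
  then obtain \<tau> where \<tau>: "\<tau> \<in> N" "chr L \<sigma> 0 \<in> \<tau>"
    using barycenter_in_cell assms(2) by blast
  moreover have "\<tau> \<in> cells L" using assms(1) \<tau> by (auto simp: subcomplex_def)
  ultimately have "\<sigma> \<subseteq> \<tau>"
    using lam_support_subset lam_barycenter assms(2) by simp
  then show "\<sigma> \<in> N" using assms \<tau> by (auto simp: subcomplex_def)
qed auto

text \<open>The carrier cell of a common point is contained in every cell through that point, so
  both subcomplexes contain it. This is what makes \<open>nu\<close> closed under
  intersection.\<close>

lemma Union_Int_subcomplex:
  assumes "subcomplex L N" "subcomplex L N'"
  shows "\<Union>(N \<inter> N') = \<Union>N \<inter> \<Union>N'"
proof (intro subset_antisym subsetI)
  fix y assume "y \<in> \<Union>N \<inter> \<Union>N'"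
  then obtain \<sigma> \<sigma>' where \<sigma>: "\<sigma> \<in> N" "y \<in> \<sigma>" "\<sigma>' \<in> N'" "y \<in> \<sigma>'" by blast
  then have c: "\<sigma> \<in> cells L" "\<sigma>' \<in> cells L" using assms by (auto simp: subcomplex_def)
  then obtain \<tau> where \<tau>: "\<tau> \<in> cells L" "y \<in> \<tau>" "0 < lam \<tau> y"
    using carrier_cell \<sigma> by blast
  then have "\<tau> \<subseteq> \<sigma>" "\<tau> \<subseteq> \<sigma>'" using lam_support_subset c \<sigma> by simp_all
  then show "y \<in> \<Union>(N \<inter> N')" using assms \<tau> \<sigma> by (auto simp: subcomplex_def)
qed auto

end

section \<open>Sets of cells and the subcomplexes they generate\<close>

lemma subcomplex_Un: "subcomplex L A \<Longrightarrow> subcomplex L B \<Longrightarrow> subcomplex L (A \<union> B)"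
  by (auto simp: subcomplex_def)

lemma subcomplex_Int: "subcomplex L A \<Longrightarrow> subcomplex L B \<Longrightarrow> subcomplex L (A \<inter> B)"
  by (auto simp: subcomplex_def)

text \<open>Cells are closed cells, so adding faces does not enlarge the union; conditions on the
  underlying point set can be tested on \<open>S\<close> alone.\<close>

definition generated :: "'a cells \<Rightarrow> 'a set set \<Rightarrow> 'a set set" where
  "generated L S = {\<tau> \<in> cells L. \<exists>\<sigma>\<in>S. \<tau> \<subseteq> \<sigma>}"

lemma subcomplex_generated: "subcomplex L (generated L S)"
  by (auto simp: subcomplex_def generated_def)

lemma subset_generated: "S \<subseteq> cells L \<Longrightarrow> S \<subseteq> generated L S"
  by (auto simp: generated_def)

lemma Union_generated: "S \<subseteq> cells L \<Longrightarrow> \<Union>(generated L S) = \<Union>S"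
  by (auto simp: generated_def)

section \<open>Convergence of cells in a scattered complex\<close>

locale scattered_complex = barycentric_complex L lam
  for L :: "'a::metric_space cells" and lam +
  fixes X :: "'a set"
  assumes open_iff: "\<And>U. U \<subseteq> - X \<Longrightarrow>
      open U \<longleftrightarrow> (\<forall>x\<in>U. \<exists>e>0. \<forall>y\<in>-X. bary_dist L lam x y < e \<longrightarrow> y \<in> U)"
    and Union_cells: "\<Union>(cells L) = - X"
    and scattered: "scattered_towards L X"
begin

text \<open>Let \<open>\<tau>\<close> be the carrier of a point \<open>y\<close> outside the
  subcomplex. All points at barycentric distance less than \<open>lam \<tau> y\<close> still have
  nonzero coordinate at \<open>\<tau>\<close>, so every cell through them contains
  \<open>\<tau>\<close> and cannot belong to \<open>A\<close>.\<close>

lemma open_minus_subcomplex: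
  assumes "subcomplex L A" shows "open (- X - \<Union>A)"
proof (subst open_iff; (intro ballI)?)
  fix y assume y: "y \<in> - X - \<Union>A"
  then have "y \<in> \<Union>(cells L)" using Union_cells by simp
  then obtain \<tau> where \<tau>: "\<tau> \<in> cells L" "y \<in> \<tau>" "0 < lam \<tau> y"
    by (rule carrier_cell)
  then have "\<tau> \<notin> A" using y by blast
  have "z \<in> - X - \<Union>A" if z: "z \<in> - X" "bary_dist L lam y z < lam \<tau> y" for z
  proof -
    have "\<bar>lam \<tau> y - lam \<tau> z\<bar> < lam \<tau> y"
      using lam_diff_le_bary_dist[of y z \<tau>] z y \<tau> Union_cells by fastforce
    then have "lam \<tau> z \<noteq> 0" by auto
    then have "\<tau> \<in> A" if "\<rho> \<in> A" "z \<in> \<rho>" for \<rho>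
      using that lam_support_subset[of \<rho> \<tau> z] \<tau> assms by (auto simp: subcomplex_def)
    then show ?thesis using \<open>\<tau> \<notin> A\<close> z by blast
  qed
  then show "\<exists>e>0. \<forall>z\<in>- X. bary_dist L lam y z < e \<longrightarrow> z \<in> - X - \<Union>A" using \<tau> by blast
qed auto

text \<open>At the carrier of \<open>y\<close>, every barycentre has coordinate 0 or 1, which keeps
  barycentres other than \<open>y\<close> at a definite distance from \<open>y\<close>. Since this
  holds for every set of barycentres, they can accumulate only in \<open>X\<close>.\<close>

lemma open_minus_barycenters:
  assumes "S \<subseteq> cells L" shows "open (- X - (\<lambda>\<sigma>. chr L \<sigma> 0) ` S)" (is "open (- X - ?D)")
proof (subst open_iff; (intro ballI)?)
  fix y assume y: "y \<in> - X - ?D"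
  then have "y \<in> \<Union>(cells L)" using Union_cells by simp
  then obtain \<tau> where \<tau>: "\<tau> \<in> cells L" "y \<in> \<tau>" "0 < lam \<tau> y"
      and \<tau>1: "lam \<tau> y = 1 \<longrightarrow> y = chr L \<tau> 0"
    by (rule carrier_cell)
  \<comment> \<open>The distance of \<open>lam \<tau> y\<close> from both values 0 and 1. If the
    coordinate is 1, then \<open>y\<close> is itself the barycentre of \<open>\<tau>\<close>, and
    only the value 0 has to be avoided.\<close>
  define e where "e = (if lam \<tau> y = 1 then 1 else min (lam \<tau> y) \<bar>1 - lam \<tau> y\<bar>)"
  have "e > 0" using \<tau> by (auto simp: e_def)
  moreover have "z \<in> - X - ?D" if z: "z \<in> - X" "bary_dist L lam y z < e" for z
  proof (rule ccontr)
    assume "z \<notin> - X - ?D"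
    then obtain \<sigma> where \<sigma>: "\<sigma> \<in> S" "z = chr L \<sigma> 0" using z by blast
    then have \<sigma>L: "\<sigma> \<in> cells L" using assms by blast
    have "\<bar>lam \<tau> y - lam \<tau> z\<bar> < e"
      using lam_diff_le_bary_dist[of y z \<tau>] z y \<tau> Union_cells by fastforce
    then show False
      using lam_barycenter[OF \<sigma>L \<tau>(1)] \<sigma> \<tau> \<tau>1 y
      by (auto simp: e_def split: if_splits)
  qed
  ultimately show "\<exists>e>0. \<forall>z\<in>- X. bary_dist L lam y z < e \<longrightarrow> z \<in> - X - ?D" by blast
qed auto

lemma finite_cells:
  assumes "S \<subseteq> cells L" "compact (closure (\<Union>S))" "closure (\<Union>S) \<subseteq> - X"
  shows "finite S"
proof (rule ccontr)
  assume "infinite S"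
  let ?b = "\<lambda>\<sigma>. chr L \<sigma> 0"
  have "inj_on ?b S"
  proof (rule inj_onI)
    fix \<sigma> \<tau> assume *: "\<sigma> \<in> S" "\<tau> \<in> S" "chr L \<sigma> 0 = chr L \<tau> 0"
    then have "\<sigma> \<in> cells L" "\<tau> \<in> cells L" using assms(1) by auto
    then show "\<sigma> = \<tau>" using *(3) by (metis lam_barycenter zero_neq_one)
  qed
  then have "infinite (?b ` S)" using \<open>infinite S\<close> finite_imageD by blast
  moreover have "?b ` S \<subseteq> closure (\<Union>S)"
    using barycenter_in_cell assms(1) closure_subset by fastforce
  ultimately obtain x where x: "x \<in> closure (\<Union>S)" "x islimpt (?b ` S)"
    using assms(2) compact_eq_Bolzano_Weierstrass by blast
  \<comment> \<open>The limit point \<open>x\<close> may be a barycentre itself, so its own cell is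
    left out before taking the complement as a neighbourhood of \<open>x\<close>.\<close>
  define S' where "S' = {\<sigma> \<in> S. ?b \<sigma> \<noteq> x}"
  have "open (- X - ?b ` S')" using assms by (intro open_minus_barycenters) (auto simp: S'_def)
  moreover have "x \<in> - X - ?b ` S'" using x assms(3) by (auto simp: S'_def)
  ultimately obtain y where "y \<in> ?b ` S" "y \<in> - X - ?b ` S'" "y \<noteq> x"
    using x(2) by (meson islimptE)
  then show False by (auto simp: S'_def)
qed

text \<open>Scatteredness allows an arbitrary point to be chosen in each cell. Choosing one outside
  the ball whenever there is one turns pointwise convergence into a statement about whole
  cells.\<close>

lemma eventually_cell_subset_ball:
  assumes "\<And>i. \<rho> i \<in> cells L" "\<And>i. w i \<in> \<rho> i" "w \<longlonglongrightarrow> x" "x \<in> X" "e > 0"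
  shows "\<forall>\<^sub>F i in sequentially. \<rho> i \<subseteq> ball x e"
proof -
  define y where "y i = (if \<rho> i \<subseteq> ball x e then w i else (SOME z. z \<in> \<rho> i - ball x e))" for i
  have y: "y i \<in> \<rho> i - ball x e" if "\<not> \<rho> i \<subseteq> ball x e" for i
  proof -
    have "\<exists>z. z \<in> \<rho> i - ball x e" using that by blast
    then show ?thesis using that unfolding y_def by (metis (mono_tags, lifting) someI_ex)
  qed
  then have "y i \<in> \<rho> i" for i using assms(2) by (cases "\<rho> i \<subseteq> ball x e") (auto simp: y_def)
  then have "y \<longlonglongrightarrow> x"
    using scattered assms unfolding scattered_towards_def by blast
  then have "\<forall>\<^sub>F i in sequentially. dist (y i) x < e" using assms(5) tendstoD by blast
  then show ?thesis
    by eventually_elim (use y in \<open>force simp: dist_commute\<close>)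
qed

text \<open>
  As the cells are scattered, they shrink to \<open>x\<close>, so adjoining \<open>x\<close> to their union makes it compact.
\<close>

lemma compact_closure_converging_cells:
  assumes "\<And>i. \<rho> i \<in> cells L" "\<And>i. w i \<in> \<rho> i" "w \<longlonglongrightarrow> x" "x \<in> X"
  shows "compact (closure (\<Union>(range \<rho>)))"
proof -
  have "compact (insert x (\<Union>(range \<rho>)))"
    unfolding compact_eq_Heine_Borel
  proof (intro allI impI)
    fix \<C> assume \<C>: "(\<forall>c\<in>\<C>. open c) \<and> insert x (\<Union>(range \<rho>)) \<subseteq> \<Union>\<C>"
    then obtain c where c: "c \<in> \<C>" "x \<in> c" "open c" by blast
    then obtain e where "e > 0" "ball x e \<subseteq> c" by (meson openE)
    then obtain m where m: "\<And>i. i \<ge> m \<Longrightarrow> \<rho> i \<subseteq> c"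
      using eventually_cell_subset_ball[OF assms] unfolding eventually_sequentially by blast
    have "compact (\<Union>i<m. \<rho> i)" using assms compact_cell by (intro compact_UN) auto
    moreover have "(\<Union>i<m. \<rho> i) \<subseteq> \<Union>\<C>" using \<C> by blast
    ultimately obtain \<D> where \<D>: "\<D> \<subseteq> \<C>" "finite \<D>" "(\<Union>i<m. \<rho> i) \<subseteq> \<Union>\<D>"
      using \<C> unfolding compact_eq_Heine_Borel by meson
    have "insert x (\<Union>(range \<rho>)) \<subseteq> \<Union>(insert c \<D>)"
    proof
      fix z assume z: "z \<in> insert x (\<Union>(range \<rho>))"
      show "z \<in> \<Union>(insert c \<D>)"
      proof (cases "z = x")
        case False
        with z obtain i where "z \<in> \<rho> i" by blast
        then show ?thesis using m[of i] \<D>(3) by (cases "i < m") auto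
      qed (use c in auto)
    qed
    then show "\<exists>\<D>\<subseteq>\<C>. finite \<D> \<and> insert x (\<Union>(range \<rho>)) \<subseteq> \<Union>\<D>"
      using \<D> c by (intro exI[of _ "insert c \<D>"]) auto
  qed
  moreover from this have "closure (\<Union>(range \<rho>)) \<subseteq> insert x (\<Union>(range \<rho>))"
    by (meson closure_minimal compact_imp_closed subset_insertI)
  ultimately show ?thesis
    using compact_Int_closed[of "insert x (\<Union>(range \<rho>))" "closure (\<Union>(range \<rho>))"]
    by (simp add: inf.absorb2)
qed

text \<open>Finitely many cells have a compact, hence closed, union, which would contain the limit
  \<open>x\<close>; but \<open>x\<close> lies in \<open>X\<close>.\<close>

lemma infinite_range_converging_cells:
  assumes "\<And>i. \<rho> i \<in> cells L" "\<And>i. w i \<in> \<rho> i" "w \<longlonglongrightarrow> x" "x \<in> X"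
  shows "infinite (range \<rho>)"
proof
  assume "finite (range \<rho>)"
  then have "compact (\<Union>(range \<rho>))"
    using assms(1) compact_cell by (intro compact_Union) auto
  then have "x \<in> \<Union>(range \<rho>)"
    using assms(2,3) by (metis UN_I UNIV_I closed_sequentially compact_imp_closed)
  then show False using assms(1,4) Union_cells by blast
qed

text \<open>A subcomplex is already closed relative to the complement of \<open>X\<close>, so limit
  points can only be missing at \<open>X\<close>.\<close>

lemma closed_Union_subcomplex_iff:
  assumes "subcomplex L A"
  shows "closed (\<Union>A) \<longleftrightarrow> closure (\<Union>A) \<inter> X = {}"
proof
  assume "closed (\<Union>A)"
  then show "closure (\<Union>A) \<inter> X = {}"
    using assms Union_cells by (auto simp: subcomplex_def closure_closed)
next
  assume *: "closure (\<Union>A) \<inter> X = {}"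
  have "closure (\<Union>A) \<inter> (- X - \<Union>A) = {}"
    using open_minus_subcomplex[OF assms] open_Int_closure_eq_empty[of "- X - \<Union>A" "\<Union>A"]
    by blast
  then have "closure (\<Union>A) = \<Union>A" using * closure_subset[of "\<Union>A"] by blast
  then show "closed (\<Union>A)" by (metis closed_closure)
qed

section \<open>Duality of \<open>kappa\<close>, \<open>nu\<close> and \<open>nu_bar\<close>\<close>

lemma kappa_subcomplex: "K \<in> kappa L \<Longrightarrow> subcomplex L K"
  by (simp add: kappa_def)

lemma nu_subcomplex: "N \<in> nu L X \<Longrightarrow> subcomplex L N"
  by (simp add: nu_def)

lemma closure_Int_X_obtain_sequence:
  assumes "S \<subseteq> cells L" "x \<in> closure (\<Union>S)"
  obtains \<rho> w where "\<And>i::nat. \<rho> i \<in> S" "\<And>i. w i \<in> \<rho> i" "w \<longlonglongrightarrow> x"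
proof -
  obtain w where w: "\<And>i. w i \<in> \<Union>S" "w \<longlonglongrightarrow> x"
    using assms(2) by (auto simp: closure_sequential)
  then have "\<exists>\<rho>. \<forall>i. \<rho> i \<in> S \<and> w i \<in> \<rho> i" by (intro choice) auto
  then show thesis using w(2) that by blast
qed

text \<open>Cells of \<open>S\<close> accumulating at a point of \<open>X\<close> would eventually
  lie entirely in the neighbourhood \<open>\<Union>N \<union> X\<close>, hence in
  \<open>\<Union>N\<close>, and thus be cells of \<open>N\<close>. Merely meeting the neighbourhood
  would not suffice for this.\<close>

lemma closure_cells_avoiding_nu:
  assumes "N \<in> nu L X" "S \<subseteq> cells L" "S \<inter> N = {}"
  shows "closure (\<Union>S) \<inter> X = {}"
proof (rule ccontr)
  assume "closure (\<Union>S) \<inter> X \<noteq> {}"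
  then obtain x where x: "x \<in> closure (\<Union>S)" "x \<in> X" by blast
  then obtain \<rho> w where \<rho>: "\<And>i. \<rho> i \<in> S" "\<And>i. w i \<in> \<rho> i" "w \<longlonglongrightarrow> x"
    using closure_Int_X_obtain_sequence assms(2) by metis
  have N: "subcomplex L N" "x \<in> interior (\<Union>N \<union> X)" using assms(1) x(2) by (auto simp: nu_def)
  then obtain e where "e > 0" and e: "ball x e \<subseteq> \<Union>N \<union> X" by (auto simp: mem_interior)
  then have "\<forall>\<^sub>F i in sequentially. \<rho> i \<subseteq> ball x e"
    using eventually_cell_subset_ball[of \<rho> w x e] \<rho> x(2) assms(2) by blast
  then obtain i where "\<rho> i \<subseteq> \<Union>N \<union> X"
    using e by (meson eventually_happens' order_trans trivial_limit_sequentially)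
  moreover have "\<rho> i \<in> cells L" using \<rho> assms(2) by blast
  ultimately have "\<rho> i \<subseteq> \<Union>N" using Union_cells by blast
  then have "\<rho> i \<in> N" using subset_cells_Union_iff N \<open>\<rho> i \<in> cells L\<close> by blast
  then show False using \<rho> assms(3) by blast
qed

lemma finite_kappa_minus_nu:
  assumes "K \<in> kappa L" "N \<in> nu L X" shows "finite (K - N)"
proof (rule finite_cells)
  show c: "K - N \<subseteq> cells L" using assms kappa_subcomplex by (auto simp: subcomplex_def)
  have "closure (\<Union>(K - N)) \<subseteq> closure (\<Union>K)" by (intro closure_mono) auto
  then show "compact (closure (\<Union>(K - N)))"
    using assms(1) compact_Int_closed[of "closure (\<Union>K)" "closure (\<Union>(K - N))"]
    by (simp add: kappa_def inf.absorb2)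
  show "closure (\<Union>(K - N)) \<subseteq> - X"
    using closure_cells_avoiding_nu[OF assms(2) c] by blast
qed

lemma generated_in_nu_bar:
  "S \<subseteq> cells L \<Longrightarrow> closure (\<Union>S) \<inter> X = {} \<Longrightarrow> generated L S \<in> nu_bar L"
  using closed_Union_subcomplex_iff[OF subcomplex_generated, of S]
  by (simp add: nu_bar_def subcomplex_generated Union_generated)

text \<open>The cells outside \<open>N\<close> need not form a subcomplex. Their faces may belong to
  \<open>N\<close>, but adding them leaves the union, and hence its distance from \<open>X\<close>,
  unchanged.\<close>

lemma generated_minus_nu_in_nu_bar:
  assumes "N \<in> nu L X" shows "generated L (cells L - N) \<in> nu_bar L"
  by (rule generated_in_nu_bar) (use closure_cells_avoiding_nu[OF assms, of "cells L - N"] in auto)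

text \<open>The cells disjoint from \<open>\<Union>F\<close> work. If they did not fill a
  neighbourhood of \<open>x\<close> in \<open>X\<close>, cells meeting \<open>F\<close> would have
  points converging to \<open>x\<close>; by scatteredness their points in \<open>F\<close> would
  converge to \<open>x\<close> as well, although \<open>F\<close> is closed and misses
  \<open>X\<close>.\<close>

lemma nu_disjoint_nu_bar:
  assumes "F \<in> nu_bar L"
  obtains N where "N \<in> nu L X" "N \<inter> F = {}"
proof
  let ?N = "{\<sigma> \<in> cells L. \<sigma> \<inter> \<Union>F = {}}"
  have F: "subcomplex L F" "closed (\<Union>F)" using assms by (auto simp: nu_bar_def)
  have "x \<in> interior (\<Union>?N \<union> X)" if "x \<in> X" for x
  proof (rule ccontr)
    assume "x \<notin> interior (\<Union>?N \<union> X)"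
    then have "x \<in> closure (- (\<Union>?N \<union> X))" by (metis ComplI closure_complement)
    moreover have "- (\<Union>?N \<union> X) \<subseteq> \<Union>(cells L - ?N)" using Union_cells by blast
    ultimately have "x \<in> closure (\<Union>(cells L - ?N))"
      by (meson closure_mono in_mono)
    then obtain \<rho> w where \<rho>: "\<And>i. \<rho> i \<in> cells L - ?N" "\<And>i. w i \<in> \<rho> i" "w \<longlonglongrightarrow> x"
      using closure_Int_X_obtain_sequence[of "cells L - ?N" x] by blast
    then have "\<exists>y. \<forall>i. y i \<in> \<rho> i \<inter> \<Union>F" by (intro choice) blast
    then obtain y where y: "\<And>i. y i \<in> \<rho> i \<inter> \<Union>F" by blast
    then have "y \<longlonglongrightarrow> x"
      using scattered \<rho> that unfolding scattered_towards_def by blast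
    then have "x \<in> \<Union>F" using F(2) y closed_sequentially by blast
    then show False using F(1) that Union_cells by (auto simp: subcomplex_def)
  qed
  then show "?N \<in> nu L X" by (auto simp: nu_def subcomplex_def)
  show "?N \<inter> F = {}"
    using barycenter_in_cell by blast
qed

lemma generated_in_kappa:
  "S \<subseteq> cells L \<Longrightarrow> compact (closure (\<Union>S)) \<Longrightarrow> generated L S \<in> kappa L"
  by (simp add: kappa_def subcomplex_generated Union_generated)

text \<open>Compactness is shown through sequences. Points in finitely many cells stay in a compact
  set. Points in infinitely many cells have those cells accumulating at some \<open>x\<close> in
  \<open>X\<close>, and since entire cells approach \<open>x\<close>, a subsequence of the given
  points does so too, however they were chosen.\<close>

lemma subset_kappa_if_finite_minus_nu:
  assumes S: "S \<subseteq> cells L" and fin: "\<And>N. N \<in> nu L X \<Longrightarrow> finite (S - N)"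
  obtains K where "K \<in> kappa L" "S \<subseteq> K"
proof -
  have sub: "\<exists>l r. strict_mono r \<and> (z \<circ> r) \<longlonglongrightarrow> l" if z: "\<And>n::nat. z n \<in> \<Union>S" for z
  proof -
    have "\<exists>\<sigma>. \<forall>n. \<sigma> n \<in> S \<and> z n \<in> \<sigma> n" using z by (intro choice) auto
    then obtain \<sigma> where \<sigma>: "\<And>n. \<sigma> n \<in> S" "\<And>n. z n \<in> \<sigma> n" by blast
    show ?thesis
    proof (cases "finite (range \<sigma>)")
      case True
      then have "compact (\<Union>(range \<sigma>))"
        using \<sigma> S compact_cell by (intro compact_Union) auto
      then show ?thesis
        using \<sigma> unfolding compact_eq_seq_compact_metric seq_compact_def by (metis UN_I UNIV_I)
    next
      case False
      have R: "range \<sigma> \<subseteq> cells L" using \<sigma> S by blast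
      \<comment> \<open>Otherwise these cells would generate a closed subcomplex, some
        \<open>N\<close> would miss it, and infinitely many cells of \<open>S\<close> would lie
        outside this \<open>N\<close>.\<close>
      have "closure (\<Union>(range \<sigma>)) \<inter> X \<noteq> {}"
      proof
        assume "closure (\<Union>(range \<sigma>)) \<inter> X = {}"
        then obtain N where N: "N \<in> nu L X" "N \<inter> generated L (range \<sigma>) = {}"
          using nu_disjoint_nu_bar generated_in_nu_bar R by metis
        then have "range \<sigma> \<subseteq> S - N" using \<sigma> subset_generated[OF R] by blast
        then show False using fin N False finite_subset by blast
      qed
      then obtain x where x: "x \<in> closure (\<Union>(range \<sigma>))" "x \<in> X" by blast
      \<comment> \<open>Indices beyond \<open>m\<close> can be demanded because the first cells form
        a closed set not containing \<open>x\<close>; the remaining ones still accumulate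
        there.\<close>
      have cluster: "\<exists>n>m. dist (z n) x < e" if "e > 0" for m e
      proof -
        let ?C = "\<Union>i\<le>m. \<sigma> i"
        have "closed ?C" 
          using \<sigma> S compact_cell compact_imp_closed by (intro closed_UN) blast+
        moreover have "x \<notin> ?C" using R x Union_cells by blast
        ultimately have "x \<notin> closure ?C" by simp
        moreover have "\<Union>(range \<sigma>) \<subseteq> ?C \<union> \<Union>(\<sigma> ` {m<..})" by force
        then have "closure (\<Union>(range \<sigma>)) \<subseteq> closure ?C \<union> closure (\<Union>(\<sigma> ` {m<..}))"
          by (metis closure_Un closure_mono)
        ultimately have "x \<in> closure (\<Union>(\<sigma> ` {m<..}))" using x by blast
        moreover have "\<sigma> ` {m<..} \<subseteq> cells L" using R by blast
        ultimately obtain \<rho> w where \<rho>: "\<And>i. \<rho> i \<in> \<sigma> ` {m<..}" "\<And>i. w i \<in> \<rho> i" "w \<longlonglongrightarrow> x"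
          using closure_Int_X_obtain_sequence by metis
        then have "\<forall>\<^sub>F i in sequentially. \<rho> i \<subseteq> ball x e"
          using eventually_cell_subset_ball[of \<rho> w x e] R x(2) that by blast
        then obtain i where "\<rho> i \<subseteq> ball x e"
          by (meson eventually_happens' trivial_limit_sequentially)
        moreover obtain n where "n > m" "\<rho> i = \<sigma> n" using \<rho>(1)[of i] by auto
        ultimately have "z n \<in> ball x e" "n > m" using \<sigma>(2)[of n] by blast+
        then show ?thesis by (auto simp: dist_commute)
      qed
      \<comment> \<open>Each successor index exceeds the previous one and comes closer to
        \<open>x\<close>. The value at 0 only starts the recursion, so convergence is read off from
        the successors and transferred back by a shift.\<close>
      define r where "r = rec_nat (SOME n. dist (z n) x < 1)
        (\<lambda>k n. SOME n'. n' > n \<and> dist (z n') x < 1 / Suc (Suc k))"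
      have step: "r k < r (Suc k) \<and> dist (z (r (Suc k))) x < 1 / Suc (Suc k)" for k
        using someI_ex[OF cluster[of "1 / Suc (Suc k)" "r k"]] by (simp add: r_def)
      have "strict_mono r" using step by (simp add: strict_mono_Suc_iff)
      moreover have "(\<lambda>k. z (r (Suc k))) \<longlonglongrightarrow> x"
      proof (rule metric_tendsto_imp_tendsto[where f = "\<lambda>k. 1 / real (Suc k)" and a = 0])
        show "(\<lambda>k. 1 / real (Suc k)) \<longlonglongrightarrow> 0" by (rule LIMSEQ_Suc[OF lim_1_over_n])
        show "\<forall>\<^sub>F k in sequentially. dist (z (r (Suc k))) x \<le> dist (1 / real (Suc k)) 0"
        proof (intro always_eventually allI)
          fix k
          have "1 / real (Suc (Suc k)) \<le> 1 / real (Suc k)" by (simp add: frac_le)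
          then show "dist (z (r (Suc k))) x \<le> dist (1 / real (Suc k)) 0"
            using step[of k] by (simp add: dist_real_def)
        qed
      qed
      then have "(z \<circ> r) \<longlonglongrightarrow> x" by (simp add: LIMSEQ_imp_Suc)
      ultimately show ?thesis by blast
    qed
  qed
  \<comment> \<open>A sequence in the closure is shadowed by one in the union itself, with errors
    \<open>1 / Suc n\<close>; convergent subsequences carry over with the same limit.\<close>
  have "seq_compact (closure (\<Union>S))"
    unfolding seq_compact_def
  proof (intro allI impI)
    fix y :: "nat \<Rightarrow> 'a" assume y: "\<forall>n. y n \<in> closure (\<Union>S)"
    have "\<exists>z. \<forall>n. z n \<in> \<Union>S \<and> dist (z n) (y n) < 1 / Suc n"
    proof (intro choice allI)
      fix n
      have "0 < 1 / real (Suc n)" by simp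
      then show "\<exists>z. z \<in> \<Union>S \<and> dist z (y n) < 1 / Suc n"
        using y closure_approachable by (metis (no_types, lifting))
    qed
    then obtain z where z: "\<And>n. z n \<in> \<Union>S" "\<And>n. dist (z n) (y n) < 1 / Suc n" by blast
    then obtain l r where r: "strict_mono r" "(z \<circ> r) \<longlonglongrightarrow> l" using sub by blast
    have "(\<lambda>n. dist (z n) (y n)) \<longlonglongrightarrow> 0"
    proof (rule tendsto_sandwich[of "\<lambda>_. 0"])
      show "(\<lambda>n. 1 / real (Suc n)) \<longlonglongrightarrow> 0" by (rule LIMSEQ_Suc[OF lim_1_over_n])
    qed (use z in \<open>auto intro!: always_eventually less_imp_le\<close>)
    then have "(\<lambda>n. dist ((z \<circ> r) n) ((y \<circ> r) n)) \<longlonglongrightarrow> 0"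
      using LIMSEQ_subseq_LIMSEQ[OF _ r(1)] by (fastforce simp: o_def)
    moreover have "(\<lambda>n. dist ((z \<circ> r) n) l) \<longlonglongrightarrow> 0"
      using r(2) tendsto_dist_iff by blast
    ultimately have
      lim: "(\<lambda>n. dist ((z \<circ> r) n) ((y \<circ> r) n) + dist ((z \<circ> r) n) l) \<longlonglongrightarrow> 0"
      using tendsto_add by fastforce
    have "(\<lambda>n. dist ((y \<circ> r) n) l) \<longlonglongrightarrow> 0"
      by (rule tendsto_sandwich[OF _ _ tendsto_const lim])
        (auto intro!: always_eventually dist_triangle3)
    then have l: "(y \<circ> r) \<longlonglongrightarrow> l" using tendsto_dist_iff by blast
    have "l \<in> closure (\<Union>S)"
      using closed_sequentially[OF closed_closure _ l] y by simp
    then show "\<exists>l\<in>closure (\<Union>S). \<exists>r. strict_mono r \<and> (y \<circ> r) \<longlonglongrightarrow> l"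
      using r(1) l by blast
  qed
  then have "generated L S \<in> kappa L"
    using S generated_in_kappa by (simp add: compact_eq_seq_compact_metric)
  then show thesis using that subset_generated[OF S] by blast
qed

text \<open>If the cells of \<open>S\<close> accumulated at \<open>X\<close>, a sequence of them
  would converge to a point there and generate a single member of \<open>kappa\<close> containing
  infinitely many cells of \<open>S\<close>. Hence \<open>S\<close> generates a closed subcomplex,
  which some \<open>N\<close> misses.\<close>

lemma disjoint_nu_if_finite_Int_kappa:
  assumes S: "S \<subseteq> cells L" and fin: "\<And>K. K \<in> kappa L \<Longrightarrow> finite (S \<inter> K)"
  obtains N where "N \<in> nu L X" "S \<inter> N = {}"
proof -
  have "closure (\<Union>S) \<inter> X = {}"
  proof (rule ccontr)
    assume "closure (\<Union>S) \<inter> X \<noteq> {}"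
    then obtain x where x: "x \<in> closure (\<Union>S)" "x \<in> X" by blast
    then obtain \<rho> w where \<rho>: "\<And>i. \<rho> i \<in> S" "\<And>i. w i \<in> \<rho> i" "w \<longlonglongrightarrow> x"
      using closure_Int_X_obtain_sequence S by metis
    then have "\<And>i. \<rho> i \<in> cells L" using S by blast
    then have "generated L (range \<rho>) \<in> kappa L" "infinite (range \<rho>)"
      using generated_in_kappa compact_closure_converging_cells[of \<rho> w x]
        infinite_range_converging_cells[of \<rho> w x] \<rho> x(2) by blast+
    moreover have "range \<rho> \<subseteq> S \<inter> generated L (range \<rho>)"
      using \<rho>(1) \<open>\<And>i. \<rho> i \<in> cells L\<close> subset_generated[of "range \<rho>" L] by blast
    ultimately show False using fin finite_subset by blast
  qed
  then obtain N where "N \<in> nu L X" "N \<inter> generated L S = {}"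
    using nu_disjoint_nu_bar generated_in_nu_bar S by metis
  then show thesis using that subset_generated[OF S] by blast
qed

lemma Un_in_kappa: "K \<in> kappa L \<Longrightarrow> K' \<in> kappa L \<Longrightarrow> K \<union> K' \<in> kappa L"
  by (simp add: kappa_def subcomplex_Un Union_Un_distrib closure_Un compact_Un)

lemma Int_in_nu:
  assumes "N \<in> nu L X" "N' \<in> nu L X" shows "N \<inter> N' \<in> nu L X"
proof -
  have "\<Union>(N \<inter> N') \<union> X = (\<Union>N \<union> X) \<inter> (\<Union>N' \<union> X)"
    using Union_Int_subcomplex nu_subcomplex assms by blast
  then show ?thesis
    using assms by (simp add: nu_def subcomplex_Int)
qed

end

section \<open>Colimits, limits and double systems\<close>

locale directed_set =
  fixes I :: "'i set" and leq :: "'i \<Rightarrow> 'i \<Rightarrow> bool"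
  assumes nonempty: "I \<noteq> {}"
    and leq_refl: "\<And>i. i \<in> I \<Longrightarrow> leq i i"
    and leq_trans: "\<And>i j k. leq i j \<Longrightarrow> leq j k \<Longrightarrow> leq i k"
    and directed: "\<And>i j. i \<in> I \<Longrightarrow> j \<in> I \<Longrightarrow> \<exists>k\<in>I. leq i k \<and> leq j k"
begin

lemma upper_bound:
  assumes "i \<in> I" "j \<in> I" obtains k where "k \<in> I" "leq i k" "leq j k"
  using directed assms by blast

end

locale direct_system = directed_set I leq
  for I :: "'i set" and leq +
  fixes A :: "'i \<Rightarrow> 'c monoid" and u :: "'i \<Rightarrow> 'i \<Rightarrow> 'c \<Rightarrow> 'c"
  assumes comm_group: "\<And>i. i \<in> I \<Longrightarrow> comm_group (A i)"
    and hom: "\<And>i k. i \<in> I \<Longrightarrow> k \<in> I \<Longrightarrow> leq i k \<Longrightarrow> u i k \<in> hom (A i) (A k)"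
    and comp: "\<And>i j k x. i \<in> I \<Longrightarrow> j \<in> I \<Longrightarrow> k \<in> I \<Longrightarrow> leq i j \<Longrightarrow> leq j k \<Longrightarrow>
        x \<in> carrier (A i) \<Longrightarrow> u j k (u i j x) = u i k x"
begin

abbreviation "cls \<equiv> colim_class I leq A u"

lemma u_closed: "i \<in> I \<Longrightarrow> k \<in> I \<Longrightarrow> leq i k \<Longrightarrow> x \<in> carrier (A i) \<Longrightarrow> u i k x \<in> carrier (A k)"
  using hom hom_in_carrier by fast

lemma group: "i \<in> I \<Longrightarrow> group (A i)"
  using comm_group comm_group_def by blast

lemma monoid: "i \<in> I \<Longrightarrow> monoid (A i)"
  using group group.is_monoid by blast

lemma equiv_colim_rel: "equiv (SIGMA i:I. carrier (A i)) (colim_rel I leq A u)"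
proof (rule equivI)
  show "trans (colim_rel I leq A u)"
  proof (rule transI)
    fix p q r assume "(p, q) \<in> colim_rel I leq A u" "(q, r) \<in> colim_rel I leq A u"
    then obtain i x j y l z k m where
      p: "p = (i, x)" "q = (j, y)" "r = (l, z)"
        and in_I: "i \<in> I" "j \<in> I" "l \<in> I" "k \<in> I" "m \<in> I"
        and in_A: "x \<in> carrier (A i)" "y \<in> carrier (A j)" "z \<in> carrier (A l)"
        and le: "leq i k" "leq j k" "leq j m" "leq l m"
        and eq: "u i k x = u j k y" "u j m y = u l m z"
      by (auto simp: colim_rel_def)
    obtain n where n: "n \<in> I" "leq k n" "leq m n" using upper_bound in_I by blast
    have "u i n x = u k n (u i k x)" using comp in_I in_A le n by simp
    also have "\<dots> = u j n y" using comp in_I in_A le n eq by simp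
    also have "\<dots> = u m n (u j m y)" using comp in_I in_A le n by simp
    also have "\<dots> = u l n z" using comp in_I in_A le n eq by simp
    finally show "(p, r) \<in> colim_rel I leq A u"
      using p in_I in_A n leq_trans[OF le(1) n(2)] leq_trans[OF le(4) n(3)]
      by (auto simp: colim_rel_def)
  qed
qed (auto simp: colim_rel_def refl_on_def sym_def intro: leq_refl)

lemma class_eq_iff:
  assumes "i \<in> I" "x \<in> carrier (A i)" "j \<in> I" "y \<in> carrier (A j)"
  shows "cls i x = cls j y \<longleftrightarrow> (\<exists>k\<in>I. leq i k \<and> leq j k \<and> u i k x = u j k y)"
  unfolding colim_class_def
  by (subst eq_equiv_class_iff[OF equiv_colim_rel]) (use assms in \<open>auto simp: colim_rel_def\<close>)

lemma in_class_iff: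
  assumes "i \<in> I" "x \<in> carrier (A i)"
  shows "(j, y) \<in> cls i x \<longleftrightarrow> j \<in> I \<and> y \<in> carrier (A j) \<and> cls j y = cls i x"
proof -
  have "(j, y) \<in> cls i x \<longleftrightarrow> j \<in> I \<and> y \<in> carrier (A j) \<and>
      (\<exists>k\<in>I. leq i k \<and> leq j k \<and> u i k x = u j k y)"
    using assms by (simp add: colim_class_def colim_rel_def)
  then show ?thesis using class_eq_iff[OF assms, of j y] by metis
qed

lemma class_self: "i \<in> I \<Longrightarrow> x \<in> carrier (A i) \<Longrightarrow> (i, x) \<in> cls i x"
  by (simp add: in_class_iff)

lemma class_u:
  assumes "i \<in> I" "k \<in> I" "leq i k" "x \<in> carrier (A i)"
  shows "cls k (u i k x) = cls i x"
proof -
  have "leq k k" using assms leq_refl by blast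
  then show ?thesis
    using class_eq_iff[of k "u i k x" i x] assms u_closed comp by blast
qed

lemma carrier_colim: "carrier (colim I leq A u) = {cls i x | i x. i \<in> I \<and> x \<in> carrier (A i)}"
  by (auto simp: colim_def quotient_def colim_class_def)

lemma class_in_colim: "i \<in> I \<Longrightarrow> x \<in> carrier (A i) \<Longrightarrow> cls i x \<in> carrier (colim I leq A u)"
  by (auto simp: carrier_colim)

lemma colim_elem:
  assumes "c \<in> carrier (colim I leq A u)"
  obtains i x where "i \<in> I" "x \<in> carrier (A i)" "c = cls i x"
  using assms by (auto simp: carrier_colim)

lemma colim_elem_above:
  assumes "c \<in> carrier (colim I leq A u)" "j \<in> I"
  obtains i x where "i \<in> I" "leq j i" "x \<in> carrier (A i)" "c = cls i x"
proof -
  obtain i x where i: "i \<in> I" "x \<in> carrier (A i)" "c = cls i x"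
    using assms(1) by (rule colim_elem)
  obtain k where k: "k \<in> I" "leq i k" "leq j k" using upper_bound assms(2) i(1) by blast
  show thesis
    by (rule that[of k "u i k x"]) (use i k class_u u_closed in auto)
qed

text \<open>With finitely many classes represented over one index, the group laws of the colimit
  reduce to those of a single \<open>A i\<close>.\<close>

lemma colim_elem2:
  assumes "c \<in> carrier (colim I leq A u)" "d \<in> carrier (colim I leq A u)"
  obtains i x y where "i \<in> I" "x \<in> carrier (A i)" "c = cls i x" "y \<in> carrier (A i)" "d = cls i y"
proof -
  obtain i x where i: "i \<in> I" "x \<in> carrier (A i)" "c = cls i x"
    using assms(1) by (rule colim_elem)
  obtain k y where k: "k \<in> I" "leq i k" "y \<in> carrier (A k)" "d = cls k y"
    using assms(2) i(1) by (rule colim_elem_above)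
  show thesis
    by (rule that[of k "u i k x" y]) (use i k class_u u_closed in auto)
qed

lemma colim_elem3:
  assumes "c \<in> carrier (colim I leq A u)" "d \<in> carrier (colim I leq A u)"
    "e \<in> carrier (colim I leq A u)"
  obtains i x y z where "i \<in> I" "x \<in> carrier (A i)" "c = cls i x" "y \<in> carrier (A i)" "d = cls i y"
    "z \<in> carrier (A i)" "e = cls i z"
proof -
  obtain i x y where i: "i \<in> I" "x \<in> carrier (A i)" "c = cls i x" "y \<in> carrier (A i)" "d = cls i y"
    using assms(1,2) by (rule colim_elem2)
  obtain k z where k: "k \<in> I" "leq i k" "z \<in> carrier (A k)" "e = cls k z"
    using assms(3) i(1) by (rule colim_elem_above)
  show thesis
    by (rule that[of k "u i k x" "u i k y" z]) (use i k class_u u_closed in auto)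
qed

text \<open>The product in \<open>colim\<close> is a union over all choices of representatives. Two
  choices agree after passing to an index above all those involved, so the union is over just one
  class.\<close>

lemma class_mult:
  assumes "i \<in> I" "x \<in> carrier (A i)" "y \<in> carrier (A i)"
  shows "cls i x \<otimes>\<^bsub>colim I leq A u\<^esub> cls i y = cls i (x \<otimes>\<^bsub>A i\<^esub> y)"
proof -
  let ?S = "{cls k (u a k x' \<otimes>\<^bsub>A k\<^esub> u b k y') | a x' b y' k.
      (a, x') \<in> cls i x \<and> (b, y') \<in> cls i y \<and> k \<in> I \<and> leq a k \<and> leq b k}"
  have "cls k (u a k x' \<otimes>\<^bsub>A k\<^esub> u b k y') = cls i (x \<otimes>\<^bsub>A i\<^esub> y)"
    if *: "(a, x') \<in> cls i x" "(b, y') \<in> cls i y" and k: "k \<in> I" "leq a k" "leq b k" for a x' b y' k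
  proof -
    have a: "a \<in> I" "x' \<in> carrier (A a)" "cls a x' = cls i x"
      and b: "b \<in> I" "y' \<in> carrier (A b)" "cls b y' = cls i y"
      using * assms by (auto simp: in_class_iff)
    obtain l where l: "l \<in> I" "leq a l" "leq i l" "u a l x' = u i l x"
      using a assms by (auto simp: class_eq_iff)
    obtain m where m: "m \<in> I" "leq b m" "leq i m" "u b m y' = u i m y"
      using b assms by (auto simp: class_eq_iff)
    obtain q where q: "q \<in> I" "leq k q" "leq l q" using upper_bound k l by blast
    obtain p where p: "p \<in> I" "leq q p" "leq m p" using upper_bound q m by blast
    have le: "leq k p" "leq l p" "leq i p" using leq_trans p q l by blast+
    have "u a p x' = u i p x" "u b p y' = u i p y"
      using comp[of a l p x'] comp[of i l p x] comp[of b m p y'] comp[of i m p y] a b assms l m p le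
      by simp_all
    moreover have "u k p (u a k x' \<otimes>\<^bsub>A k\<^esub> u b k y') = u a p x' \<otimes>\<^bsub>A p\<^esub> u b p y'"
      using hom_mult[OF hom[of k p]] comp u_closed a b k p le by simp
    moreover have "u i p (x \<otimes>\<^bsub>A i\<^esub> y) = u i p x \<otimes>\<^bsub>A p\<^esub> u i p y"
      using hom_mult[OF hom[of i p]] assms p le by simp
    ultimately have "u k p (u a k x' \<otimes>\<^bsub>A k\<^esub> u b k y') = u i p (x \<otimes>\<^bsub>A i\<^esub> y)" by simp
    moreover have "u a k x' \<otimes>\<^bsub>A k\<^esub> u b k y' \<in> carrier (A k)" "x \<otimes>\<^bsub>A i\<^esub> y \<in> carrier (A i)"
      using u_closed a b k assms monoid.m_closed[OF monoid] by simp_all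
    ultimately show ?thesis using class_eq_iff k p le assms by blast
  qed
  then have "?S \<subseteq> {cls i (x \<otimes>\<^bsub>A i\<^esub> y)}" by auto
  moreover have "cls i (u i i x \<otimes>\<^bsub>A i\<^esub> u i i y) \<in> ?S"
    using class_self assms leq_refl
    by (intro CollectI exI[of _ i] exI[of _ x] exI[of _ y]) auto
  ultimately have "?S = {cls i (x \<otimes>\<^bsub>A i\<^esub> y)}" by blast
  then have "\<Union>?S = cls i (x \<otimes>\<^bsub>A i\<^esub> y)" by simp
  then show ?thesis by (simp add: colim_def)
qed

text \<open>Transition maps preserve the identity and any two indices have a common bound, so the
  union defining the unit is again over a single class.\<close>

lemma class_one:
  assumes "i \<in> I" shows "\<one>\<^bsub>colim I leq A u\<^esub> = cls i \<one>\<^bsub>A i\<^esub>"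
proof -
  have "cls j \<one>\<^bsub>A j\<^esub> = cls i \<one>\<^bsub>A i\<^esub>" if "j \<in> I" for j
  proof -
    obtain k where k: "k \<in> I" "leq i k" "leq j k" using upper_bound assms \<open>j \<in> I\<close> by blast
    then have "u i k \<one>\<^bsub>A i\<^esub> = u j k \<one>\<^bsub>A j\<^esub>"
      using hom_one hom group assms that by metis
    then show ?thesis
      using class_eq_iff[of j "\<one>\<^bsub>A j\<^esub>" i "\<one>\<^bsub>A i\<^esub>"] k assms that monoid.one_closed[OF monoid] by metis
  qed
  then have "(\<Union>j\<in>I. cls j \<one>\<^bsub>A j\<^esub>) = (\<Union>j\<in>I. cls i \<one>\<^bsub>A i\<^esub>)" by (rule SUP_cong[OF refl])
  then show ?thesis using nonempty by (simp add: colim_def)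
qed

lemma comm_group_colim: "comm_group (colim I leq A u)" (is "comm_group ?C")
proof (rule comm_groupI)
  fix c d assume "c \<in> carrier ?C" "d \<in> carrier ?C"
  then obtain i x y where i: "i \<in> I" "x \<in> carrier (A i)" "c = cls i x" "y \<in> carrier (A i)" "d = cls i y"
    by (rule colim_elem2)
  then interpret comm_group "A i" using comm_group by blast
  show "c \<otimes>\<^bsub>?C\<^esub> d \<in> carrier ?C" "c \<otimes>\<^bsub>?C\<^esub> d = d \<otimes>\<^bsub>?C\<^esub> c"
    using i m_comm[of x y] by (simp_all add: class_mult class_in_colim)
next
  fix c d e assume "c \<in> carrier ?C" "d \<in> carrier ?C" "e \<in> carrier ?C"
  then obtain i x y z where i: "i \<in> I" "x \<in> carrier (A i)" "c = cls i x" "y \<in> carrier (A i)"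
      "d = cls i y" "z \<in> carrier (A i)" "e = cls i z"
    by (rule colim_elem3)
  then interpret comm_group "A i" using comm_group by blast
  show "c \<otimes>\<^bsub>?C\<^esub> d \<otimes>\<^bsub>?C\<^esub> e = c \<otimes>\<^bsub>?C\<^esub> (d \<otimes>\<^bsub>?C\<^esub> e)"
    using i by (simp add: class_mult m_assoc)
next
  obtain i where i: "i \<in> I" using nonempty by blast
  then interpret comm_group "A i" using comm_group by blast
  show "\<one>\<^bsub>?C\<^esub> \<in> carrier ?C" using i by (simp add: class_one class_in_colim)
next
  fix c assume "c \<in> carrier ?C"
  then obtain i x where i: "i \<in> I" "x \<in> carrier (A i)" "c = cls i x" by (rule colim_elem)
  then interpret comm_group "A i" using comm_group by blast
  show "\<one>\<^bsub>?C\<^esub> \<otimes>\<^bsub>?C\<^esub> c = c" using i by (simp add: class_one class_mult)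
  show "\<exists>d\<in>carrier ?C. d \<otimes>\<^bsub>?C\<^esub> c = \<one>\<^bsub>?C\<^esub>"
    using i by (intro bexI[of _ "cls i (inv\<^bsub>A i\<^esub> x)"]) (simp_all add: class_one class_mult class_in_colim)
qed

end

text \<open>The element types differ so that the projections of a limit to one of its coordinates,
  from which the interchange map is built, are an instance.\<close>

locale direct_system_map =
  source: direct_system I leq A u + target: direct_system I leq B w
  for I :: "'i set" and leq and A :: "'i \<Rightarrow> 'c monoid" and u and B :: "'i \<Rightarrow> 'd monoid" and w +
  fixes f :: "'i \<Rightarrow> 'c \<Rightarrow> 'd"
  assumes f_hom: "\<And>i. i \<in> I \<Longrightarrow> f i \<in> hom (A i) (B i)"
    and f_natural: "\<And>i k x. i \<in> I \<Longrightarrow> k \<in> I \<Longrightarrow> leq i k \<Longrightarrow> x \<in> carrier (A i) \<Longrightarrow>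
        f k (u i k x) = w i k (f i x)"
begin

lemma f_closed: "i \<in> I \<Longrightarrow> x \<in> carrier (A i) \<Longrightarrow> f i x \<in> carrier (B i)"
  using f_hom hom_in_carrier by fast

lemma colim_map_class:
  assumes "i \<in> I" "x \<in> carrier (A i)"
  shows "colim_map I leq B w f (source.cls i x) = target.cls i (f i x)"
proof -
  have "target.cls j (f j y) = target.cls i (f i x)" if "(j, y) \<in> source.cls i x" for j y
  proof -
    have j: "j \<in> I" "y \<in> carrier (A j)" "source.cls j y = source.cls i x"
      using that assms by (auto simp: source.in_class_iff)
    then obtain k where k: "k \<in> I" "leq j k" "leq i k" "u j k y = u i k x"
      using assms by (auto simp: source.class_eq_iff)
    then have "w j k (f j y) = w i k (f i x)" using f_natural j assms by metis
    then show ?thesis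
      using target.class_eq_iff f_closed j k assms by metis
  qed
  then have "{target.cls j (f j y) | j y. (j, y) \<in> source.cls i x} \<subseteq> {target.cls i (f i x)}"
    by auto
  moreover have "(i, x) \<in> source.cls i x" using assms by (rule source.class_self)
  then have "target.cls i (f i x) \<in> {target.cls j (f j y) | j y. (j, y) \<in> source.cls i x}"
    by (intro CollectI exI[of _ i] exI[of _ x]) simp
  ultimately have "{target.cls j (f j y) | j y. (j, y) \<in> source.cls i x} = {target.cls i (f i x)}"
    by blast
  then show ?thesis by (simp add: colim_map_def)
qed

lemma colim_map_hom: "colim_map I leq B w f \<in> hom (colim I leq A u) (colim I leq B w)"
proof (rule homI)
  fix c assume "c \<in> carrier (colim I leq A u)"
  then obtain i x where "i \<in> I" "x \<in> carrier (A i)" "c = source.cls i x"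
    by (rule source.colim_elem)
  then show "colim_map I leq B w f c \<in> carrier (colim I leq B w)"
    by (simp add: colim_map_class target.class_in_colim f_closed)
next
  fix c d assume "c \<in> carrier (colim I leq A u)" "d \<in> carrier (colim I leq A u)"
  then obtain i x y where i: "i \<in> I" "x \<in> carrier (A i)" "c = source.cls i x"
      "y \<in> carrier (A i)" "d = source.cls i y"
    by (rule source.colim_elem2)
  then have "x \<otimes>\<^bsub>A i\<^esub> y \<in> carrier (A i)" by (simp add: monoid.m_closed[OF source.monoid])
  then show "colim_map I leq B w f (c \<otimes>\<^bsub>colim I leq A u\<^esub> d) =
      colim_map I leq B w f c \<otimes>\<^bsub>colim I leq B w\<^esub> colim_map I leq B w f d"
    using i hom_mult[OF f_hom[of i]]
    by (simp add: colim_map_class source.class_mult target.class_mult f_closed)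
qed

end

section \<open>Inverse limits of abelian groups\<close>

lemma comm_group_lim_group:
  assumes grp: "\<And>j. j \<in> J \<Longrightarrow> comm_group (A j)"
    and hom: "\<And>j k. j \<in> J \<Longrightarrow> k \<in> J \<Longrightarrow> leq j k \<Longrightarrow> v j k \<in> hom (A k) (A j)"
  shows "comm_group (lim_group J leq A v)" (is "comm_group ?L")
proof (rule comm_groupI)
  have g: "group (A j)" if "j \<in> J" for j using grp[OF that] comm_group_def by blast
  have m: "monoid (A j)" if "j \<in> J" for j using g[OF that] group.is_monoid by blast
  show "\<one>\<^bsub>?L\<^esub> \<in> carrier ?L"
    using hom_one[OF hom] g by (auto simp: lim_group_def monoid.one_closed[OF m])
  fix x assume x: "x \<in> carrier ?L"
  then have xc: "x j \<in> carrier (A j)" if "j \<in> J" for j using that by (auto simp: lim_group_def)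
  have xe: "x \<in> extensional J" using x by (auto simp: lim_group_def PiE_def)
  show "\<one>\<^bsub>?L\<^esub> \<otimes>\<^bsub>?L\<^esub> x = x"
    using xc by (auto simp: lim_group_def monoid.l_one[OF m] extensional_arb[OF xe] restrict_def)
  let ?y = "\<lambda>j\<in>J. inv\<^bsub>A j\<^esub> x j"
  have "v j k (inv\<^bsub>A k\<^esub> x k) = inv\<^bsub>A j\<^esub> x j" if "j \<in> J" "k \<in> J" "leq j k" for j k
  proof -
    have "v j k (inv\<^bsub>A k\<^esub> x k) = inv\<^bsub>A j\<^esub> (v j k (x k))"
      using hom[OF that] g xc that by (simp add: group_hom.hom_inv group_hom_def group_hom_axioms_def)
    then show ?thesis using x that by (auto simp: lim_group_def)
  qed
  then have "?y \<in> carrier ?L"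
    using xc by (auto simp: lim_group_def group.inv_closed[OF g])
  moreover have "?y \<otimes>\<^bsub>?L\<^esub> x = \<one>\<^bsub>?L\<^esub>"
    using xc by (auto simp: lim_group_def group.l_inv[OF g] restrict_def)
  ultimately show "\<exists>y\<in>carrier ?L. y \<otimes>\<^bsub>?L\<^esub> x = \<one>\<^bsub>?L\<^esub>" by blast
  fix y assume y: "y \<in> carrier ?L"
  then have yc: "y j \<in> carrier (A j)" if "j \<in> J" for j using that by (auto simp: lim_group_def)
  show "x \<otimes>\<^bsub>?L\<^esub> y \<in> carrier ?L"
    using x y hom_mult[OF hom] xc yc by (auto simp: lim_group_def monoid.m_closed[OF m])
  show "x \<otimes>\<^bsub>?L\<^esub> y = y \<otimes>\<^bsub>?L\<^esub> x"
    using xc yc comm_monoid.m_comm[OF comm_group.axioms(1)[OF grp]]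
    by (auto simp: lim_group_def restrict_def)
  fix z assume z: "z \<in> carrier ?L"
  then have zc: "z j \<in> carrier (A j)" if "j \<in> J" for j using that by (auto simp: lim_group_def)
  show "x \<otimes>\<^bsub>?L\<^esub> y \<otimes>\<^bsub>?L\<^esub> z = x \<otimes>\<^bsub>?L\<^esub> (y \<otimes>\<^bsub>?L\<^esub> z)"
    using xc yc zc by (auto simp: lim_group_def monoid.m_assoc[OF m] restrict_def)
qed

lemma lim_group_iff:
  "x \<in> carrier (lim_group J leq A v) \<longleftrightarrow>
     x \<in> extensional J \<and> (\<forall>j\<in>J. x j \<in> carrier (A j)) \<and>
     (\<forall>j\<in>J. \<forall>k\<in>J. leq j k \<longrightarrow> v j k (x k) = x j)"
  by (auto simp: lim_group_def PiE_iff)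

lemma lim_group_mult: "x \<otimes>\<^bsub>lim_group J leq A v\<^esub> y = (\<lambda>j\<in>J. x j \<otimes>\<^bsub>A j\<^esub> y j)"
  by (simp add: lim_group_def)

lemma lim_map_hom:
  assumes hom: "\<And>j. j \<in> J \<Longrightarrow> f j \<in> hom (A j) (B j)"
    and natural: "\<And>j k x. j \<in> J \<Longrightarrow> k \<in> J \<Longrightarrow> leq j k \<Longrightarrow> x \<in> carrier (A k) \<Longrightarrow>
        f j (v j k x) = w j k (f k x)"
  shows "lim_map J f \<in> hom (lim_group J leq A v) (lim_group J leq B w)"
proof (rule homI)
  fix x assume x: "x \<in> carrier (lim_group J leq A v)"
  then have "w j k (f k (x k)) = f j (x j)" if "j \<in> J" "k \<in> J" "leq j k" for j k
    using natural[OF that] that by (metis lim_group_iff)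
  then show "lim_map J f x \<in> carrier (lim_group J leq B w)"
    using x hom_in_carrier[OF hom] by (simp add: lim_group_iff lim_map_def)
next
  fix x y assume "x \<in> carrier (lim_group J leq A v)" "y \<in> carrier (lim_group J leq A v)"
  then show "lim_map J f (x \<otimes>\<^bsub>lim_group J leq A v\<^esub> y) =
      lim_map J f x \<otimes>\<^bsub>lim_group J leq B w\<^esub> lim_map J f y"
    using hom_mult[OF hom] by (auto simp: lim_group_mult lim_map_def lim_group_iff restrict_def)
qed

section \<open>The interchange map of a double system and its naturality\<close>

locale double_system = directed_set I leI + J: directed_set J leJ
  for I :: "'i set" and leI and J :: "'j set" and leJ +
  fixes F :: "'i \<Rightarrow> 'j \<Rightarrow> 'c monoid" and u :: "'i \<Rightarrow> 'i \<Rightarrow> 'j \<Rightarrow> 'c \<Rightarrow> 'c"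
    and v :: "'i \<Rightarrow> 'j \<Rightarrow> 'j \<Rightarrow> 'c \<Rightarrow> 'c"
  assumes comm_group: "\<And>i j. i \<in> I \<Longrightarrow> j \<in> J \<Longrightarrow> comm_group (F i j)"
    and u_hom: "\<And>i k j. i \<in> I \<Longrightarrow> k \<in> I \<Longrightarrow> j \<in> J \<Longrightarrow> leI i k \<Longrightarrow> u i k j \<in> hom (F i j) (F k j)"
    and u_comp: "\<And>i k l j x. i \<in> I \<Longrightarrow> k \<in> I \<Longrightarrow> l \<in> I \<Longrightarrow> j \<in> J \<Longrightarrow> leI i k \<Longrightarrow> leI k l \<Longrightarrow>
        x \<in> carrier (F i j) \<Longrightarrow> u k l j (u i k j x) = u i l j x"
    and v_hom: "\<And>i j k. i \<in> I \<Longrightarrow> j \<in> J \<Longrightarrow> k \<in> J \<Longrightarrow> leJ j k \<Longrightarrow> v i j k \<in> hom (F i k) (F i j)"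
    and uv: "\<And>i i' j k x. i \<in> I \<Longrightarrow> i' \<in> I \<Longrightarrow> j \<in> J \<Longrightarrow> k \<in> J \<Longrightarrow> leI i i' \<Longrightarrow> leJ j k \<Longrightarrow>
        x \<in> carrier (F i k) \<Longrightarrow> v i' j k (u i i' k x) = u i i' j (v i j k x)"
begin

abbreviation "lims i \<equiv> lim_group J leJ (F i) (v i)"
abbreviation "lim_u i k \<equiv> lim_map J (u i k)"
abbreviation "colims j \<equiv> colim I leI (\<lambda>i. F i j) (\<lambda>i k. u i k j)"
abbreviation "colim_v j k \<equiv> colim_map I leI (\<lambda>i. F i j) (\<lambda>i k. u i k j) (\<lambda>i. v i j k)"
abbreviation "CL \<equiv> colim_lim I leI J leJ F u v"
abbreviation "LC \<equiv> lim_colim I leI J leJ F u v"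
abbreviation "lim_cls \<equiv> colim_class I leI lims lim_u"
abbreviation "F_cls j \<equiv> colim_class I leI (\<lambda>i. F i j) (\<lambda>i k. u i k j)"

lemma direct_system_F: "j \<in> J \<Longrightarrow> direct_system I leI (\<lambda>i. F i j) (\<lambda>i k. u i k j)"
  using comm_group u_hom u_comp
  by (intro direct_system.intro direct_system_axioms.intro directed_set_axioms) auto

lemma direct_system_lims: "direct_system I leI lims lim_u"
proof (intro direct_system.intro direct_system_axioms.intro directed_set_axioms)
  show "comm_group (lims i)" if "i \<in> I" for i
    using comm_group_lim_group comm_group v_hom that by metis
  show "lim_u i k \<in> hom (lims i) (lims k)" if "i \<in> I" "k \<in> I" "leI i k" for i k
    using that u_hom uv by (intro lim_map_hom) auto
  show "lim_u j k (lim_u i j x) = lim_u i k x"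
    if "i \<in> I" "j \<in> I" "k \<in> I" "leI i j" "leI j k" "x \<in> carrier (lims i)" for i j k x
    using that u_comp by (auto simp: lim_map_def lim_group_iff)
qed

lemma direct_system_map_v:
  assumes "j \<in> J" "k \<in> J" "leJ j k"
  shows "direct_system_map I leI (\<lambda>i. F i k) (\<lambda>i l. u i l k) (\<lambda>i. F i j) (\<lambda>i l. u i l j) (\<lambda>i. v i j k)"
  using assms v_hom uv
  by (auto simp: direct_system_map_def direct_system_map_axioms_def direct_system_F)

lemma direct_system_map_proj:
  assumes "j \<in> J"
  shows "direct_system_map I leI lims lim_u (\<lambda>i. F i j) (\<lambda>i l. u i l j) (\<lambda>i x. x j)"
  using assms
  by (auto simp: direct_system_map_def direct_system_map_axioms_def direct_system_F
      direct_system_lims lim_group_mult lim_group_iff lim_map_def intro!: homI)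

lemma comm_group_CL: "comm_group CL"
  unfolding colim_lim_def using direct_system.comm_group_colim[OF direct_system_lims] .

lemma comm_group_LC: "comm_group LC"
  unfolding lim_colim_def
  using direct_system.comm_group_colim[OF direct_system_F]
    direct_system_map.colim_map_hom[OF direct_system_map_v]
  by (intro comm_group_lim_group) auto

lemma CL_elem:
  assumes "c \<in> carrier CL"
  obtains i x where "i \<in> I" "x \<in> carrier (lims i)" "c = lim_cls i x"
  using assms unfolding colim_lim_def by (rule direct_system.colim_elem[OF direct_system_lims])

lemma CL_elem2:
  assumes "c \<in> carrier CL" "d \<in> carrier CL"
  obtains i x y where "i \<in> I" "x \<in> carrier (lims i)" "c = lim_cls i x"
    "y \<in> carrier (lims i)" "d = lim_cls i y"
  using assms unfolding colim_lim_def by (rule direct_system.colim_elem2[OF direct_system_lims])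

lemma interchange_class:
  assumes "i \<in> I" "x \<in> carrier (lims i)"
  shows "interchange I leI J F u (lim_cls i x) = (\<lambda>j\<in>J. F_cls j i (x j))"
  unfolding interchange_def
  using direct_system_map.colim_map_class[OF direct_system_map_proj assms] by (intro restrict_ext) simp

lemma interchange_hom: "interchange I leI J F u \<in> hom CL LC"
proof (rule homI)
  fix c assume "c \<in> carrier CL"
  then obtain i x where i: "i \<in> I" "x \<in> carrier (lims i)" "c = lim_cls i x" by (rule CL_elem)
  have "colim_v j k (F_cls k i (x k)) = F_cls j i (x j)" if "j \<in> J" "k \<in> J" "leJ j k" for j k
    using direct_system_map.colim_map_class[OF direct_system_map_v[OF that], of i "x k"] i that
    by (auto simp: lim_group_iff)
  then show "interchange I leI J F u c \<in> carrier LC"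
    using i direct_system.class_in_colim[OF direct_system_F]
    by (auto simp: interchange_class lim_colim_def lim_group_iff)
next
  fix c d assume cd: "c \<in> carrier CL" "d \<in> carrier CL"
  have "colim_map I leI (\<lambda>i. F i j) (\<lambda>i k. u i k j) (\<lambda>i x. x j) (c \<otimes>\<^bsub>CL\<^esub> d) =
      colim_map I leI (\<lambda>i. F i j) (\<lambda>i k. u i k j) (\<lambda>i x. x j) c \<otimes>\<^bsub>colims j\<^esub>
      colim_map I leI (\<lambda>i. F i j) (\<lambda>i k. u i k j) (\<lambda>i x. x j) d" if "j \<in> J" for j
    using hom_mult[OF direct_system_map.colim_map_hom[OF direct_system_map_proj[OF that]]] cd
    unfolding colim_lim_def by blast
  then show "interchange I leI J F u (c \<otimes>\<^bsub>CL\<^esub> d) =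
      interchange I leI J F u c \<otimes>\<^bsub>LC\<^esub> interchange I leI J F u d"
    unfolding interchange_def lim_colim_def lim_group_mult by (intro restrict_ext) simp
qed

text \<open>Equality in the colimit at \<open>j\<close> holds after some transition map, whose
  target may vary with \<open>j\<close>. Injectivity of the transition maps brings all these
  equalities back to the one index \<open>i\<close>.\<close>

lemma inj_on_interchange:
  assumes inj: "\<And>i k j. i \<in> I \<Longrightarrow> k \<in> I \<Longrightarrow> j \<in> J \<Longrightarrow> leI i k \<Longrightarrow> inj_on (u i k j) (carrier (F i j))"
  shows "inj_on (interchange I leI J F u) (carrier CL)"
proof (rule inj_onI)
  fix c d assume cd: "c \<in> carrier CL" "d \<in> carrier CL"
    and eq: "interchange I leI J F u c = interchange I leI J F u d"
  from cd obtain i x y where i: "i \<in> I" "x \<in> carrier (lims i)" "c = lim_cls i x"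
      "y \<in> carrier (lims i)" "d = lim_cls i y"
    by (rule CL_elem2)
  have "x j = y j" if j: "j \<in> J" for j
  proof -
    have xy: "x j \<in> carrier (F i j)" "y j \<in> carrier (F i j)" using i j by (auto simp: lim_group_iff)
    have "F_cls j i (x j) = F_cls j i (y j)"
      using fun_cong[OF eq, of j] i j by (simp add: interchange_class)
    then obtain k where k: "k \<in> I" "leI i k" "u i k j (x j) = u i k j (y j)"
      using direct_system.class_eq_iff[OF direct_system_F[OF j] i(1) xy(1) i(1) xy(2)] by blast
    show ?thesis using inj_onD[OF inj[OF i(1) k(1) j k(2)] k(3) xy] .
  qed
  then have "x = y" using i by (auto simp: lim_group_iff intro: extensionalityI)
  then show "c = d" using i by simp
qed

end

locale double_system_map =
  source: double_system I leI J leJ F u v + target: double_system I leI J leJ F' u' v'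
  for I :: "'i set" and leI and J :: "'j set" and leJ
    and F :: "'i \<Rightarrow> 'j \<Rightarrow> 'c monoid" and u v and F' :: "'i \<Rightarrow> 'j \<Rightarrow> 'c monoid" and u' v' +
  fixes f :: "'i \<Rightarrow> 'j \<Rightarrow> 'c \<Rightarrow> 'c"
  assumes f_hom: "\<And>i j. i \<in> I \<Longrightarrow> j \<in> J \<Longrightarrow> f i j \<in> hom (F i j) (F' i j)"
    and f_u: "\<And>i k j x. i \<in> I \<Longrightarrow> k \<in> I \<Longrightarrow> j \<in> J \<Longrightarrow> leI i k \<Longrightarrow> x \<in> carrier (F i j) \<Longrightarrow>
        f k j (u i k j x) = u' i k j (f i j x)"
    and f_v: "\<And>i j k x. i \<in> I \<Longrightarrow> j \<in> J \<Longrightarrow> k \<in> J \<Longrightarrow> leJ j k \<Longrightarrow> x \<in> carrier (F i k) \<Longrightarrow>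
        f i j (v i j k x) = v' i j k (f i k x)"
begin

abbreviation "cl_map \<equiv> colim_lim_map I leI J leJ F' u' v' f"
abbreviation "lc_map \<equiv> lim_colim_map I leI J F' u' f"

lemma lim_map_f_hom: "i \<in> I \<Longrightarrow> lim_map J (f i) \<in> hom (source.lims i) (target.lims i)"
  using f_hom f_v by (intro lim_map_hom) auto

lemma direct_system_map_lim:
  "direct_system_map I leI source.lims source.lim_u target.lims target.lim_u (\<lambda>i. lim_map J (f i))"
proof -
  have "lim_map J (f k) (lim_map J (u i k) x) = lim_map J (u' i k) (lim_map J (f i) x)"
    if "i \<in> I" "k \<in> I" "leI i k" "x \<in> carrier (source.lims i)" for i k x
    using that f_u by (auto simp: lim_map_def lim_group_iff)
  then show ?thesis
    using lim_map_f_hom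
    by (auto simp: direct_system_map_def direct_system_map_axioms_def source.direct_system_lims
        target.direct_system_lims)
qed

lemma direct_system_map_f:
  assumes "j \<in> J"
  shows "direct_system_map I leI (\<lambda>i. F i j) (\<lambda>i l. u i l j) (\<lambda>i. F' i j) (\<lambda>i l. u' i l j) (\<lambda>i. f i j)"
  using assms f_hom f_u
  by (auto simp: direct_system_map_def direct_system_map_axioms_def source.direct_system_F
      target.direct_system_F)

lemma colim_lim_map_hom: "cl_map \<in> hom source.CL target.CL"
  unfolding colim_lim_map_def colim_lim_def
  by (rule direct_system_map.colim_map_hom[OF direct_system_map_lim])

lemma lim_colim_map_hom: "lc_map \<in> hom source.LC target.LC"
  unfolding lim_colim_map_def lim_colim_def
proof (rule lim_map_hom)
  show "colim_map I leI (\<lambda>i. F' i j) (\<lambda>i k. u' i k j) (\<lambda>i. f i j) \<in> hom (source.colims j) (target.colims j)"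
    if "j \<in> J" for j
    by (rule direct_system_map.colim_map_hom[OF direct_system_map_f[OF that]])
next
  fix j k c assume jk: "j \<in> J" "k \<in> J" "leJ j k" and c: "c \<in> carrier (source.colims k)"
  obtain i x where i: "i \<in> I" "x \<in> carrier (F i k)" "c = source.F_cls k i x"
    using c by (rule direct_system.colim_elem[OF source.direct_system_F[OF jk(2)]])
  have "v i j k x \<in> carrier (F i j)" "f i k x \<in> carrier (F' i k)"
    using i jk source.v_hom f_hom by (meson hom_in_carrier)+
  then show "colim_map I leI (\<lambda>i. F' i j) (\<lambda>i k. u' i k j) (\<lambda>i. f i j) (source.colim_v j k c) =
      target.colim_v j k (colim_map I leI (\<lambda>i. F' i k) (\<lambda>i l. u' i l k) (\<lambda>i. f i k) c)"
    using i jk f_v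
      direct_system_map.colim_map_class[OF source.direct_system_map_v[OF jk]]
      direct_system_map.colim_map_class[OF target.direct_system_map_v[OF jk]]
      direct_system_map.colim_map_class[OF direct_system_map_f]
    by simp
qed

text \<open>On the class of a compatible family \<open>x\<close> at \<open>i\<close>, both sides
  have the class of \<open>f i j (x j)\<close> as their value at \<open>j\<close>.\<close>

lemma interchange_natural:
  assumes "c \<in> carrier source.CL"
  shows "interchange I leI J F' u' (cl_map c) = lc_map (interchange I leI J F u c)"
proof -
  obtain i x where i: "i \<in> I" "x \<in> carrier (source.lims i)" "c = source.lim_cls i x"
    using assms by (rule source.CL_elem)
  have "cl_map c = target.lim_cls i (lim_map J (f i) x)"
    unfolding colim_lim_map_def
    using direct_system_map.colim_map_class[OF direct_system_map_lim] i by simp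
  moreover have "lim_map J (f i) x \<in> carrier (target.lims i)"
    using lim_map_f_hom i hom_in_carrier by fast
  moreover have "x j \<in> carrier (F i j)" if "j \<in> J" for j using i that by (auto simp: lim_group_iff)
  ultimately have "interchange I leI J F' u' (cl_map c) = (\<lambda>j\<in>J. target.F_cls j i (lim_map J (f i) x j))"
    "lc_map (interchange I leI J F u c) = (\<lambda>j\<in>J. target.F_cls j i (lim_map J (f i) x j))"
    using i
    by (auto simp: target.interchange_class source.interchange_class lim_colim_map_def lim_map_def
        direct_system_map.colim_map_class[OF direct_system_map_f] intro!: restrict_ext)
  then show ?thesis by simp
qed

end

section \<open>Double systems of products\<close>

text \<open>Extension by the identity and restriction in one formula, so that the structure maps in
  either variance are instances and a single commutation lemma serves both.\<close>

definition extend_restrict :: "'g monoid \<Rightarrow> 's set \<Rightarrow> 's set \<Rightarrow> ('s \<Rightarrow> 'g) \<Rightarrow> 's \<Rightarrow> 'g" where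
  "extend_restrict G S T g = (\<lambda>\<sigma>\<in>T. if \<sigma> \<in> S then g \<sigma> else \<one>\<^bsub>G\<^esub>)"

lemma induced_map_eq:
  "induced_map L G n (A, B) (A', B') =
     extend_restrict G (cells_of_dim L n (A - B)) (cells_of_dim L n (A' - B'))"
  by (simp add: induced_map_def extend_restrict_def fun_eq_iff)

lemma extend_restrict_hom:
  assumes "comm_group G"
  shows "extend_restrict G S T \<in> hom (product_group S (\<lambda>_. G)) (product_group T (\<lambda>_. G))"
proof -
  interpret comm_group G by fact
  show ?thesis
    by (rule homI) (auto simp: extend_restrict_def PiE_iff intro!: restrict_ext)
qed

text \<open>Applied to the finite sets of cells in \<open>K - N\<close>, this puts chains and
  cochains under the same abstract treatment.\<close>

lemma sum_group_eq_product_group: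
  assumes "finite S" "group G"
  shows "sum_group S (\<lambda>_. G) = product_group S (\<lambda>_. G)"
proof (rule monoid.equality)
  show "carrier (sum_group S (\<lambda>_. G)) = carrier (product_group S (\<lambda>_. G))"
    using assms by (auto simp: carrier_sum_group)
qed (use assms in simp_all)

lemma comm_group_product_group:
  assumes "comm_group G" shows "comm_group (product_group S (\<lambda>_. G))"
proof -
  interpret comm_group G by fact
  show ?thesis
    by (rule group.group_comm_groupI) (auto intro!: restrict_ext m_comm)
qed

text \<open>For chains the sets \<open>D\<close> come from \<open>kappa\<close> and the sets
  \<open>E\<close> from complements of members of \<open>nu\<close>; for cochains the roles are
  exchanged. The maps \<open>u\<close> extend by the identity and the maps \<open>v\<close>
  restrict.\<close>

locale restricted_products = directed_set I leI + J: directed_set J leJ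
  for I :: "'i set" and leI and J :: "'j set" and leJ +
  fixes G :: "'g monoid" and D :: "'i \<Rightarrow> 's set" and E :: "'j \<Rightarrow> 's set"
    and F :: "'i \<Rightarrow> 'j \<Rightarrow> ('s \<Rightarrow> 'g) monoid" and u v
  assumes coeff: "comm_group G"
    and D_mono: "\<And>i k. i \<in> I \<Longrightarrow> k \<in> I \<Longrightarrow> leI i k \<Longrightarrow> D i \<subseteq> D k"
    and E_mono: "\<And>j k. j \<in> J \<Longrightarrow> k \<in> J \<Longrightarrow> leJ j k \<Longrightarrow> E j \<subseteq> E k"
    and F_eq: "\<And>i j. i \<in> I \<Longrightarrow> j \<in> J \<Longrightarrow> F i j = product_group (D i \<inter> E j) (\<lambda>_. G)"
    and u_eq: "\<And>i k j. i \<in> I \<Longrightarrow> k \<in> I \<Longrightarrow> j \<in> J \<Longrightarrow>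
        u i k j = extend_restrict G (D i \<inter> E j) (D k \<inter> E j)"
    and v_eq: "\<And>i j k. i \<in> I \<Longrightarrow> j \<in> J \<Longrightarrow> k \<in> J \<Longrightarrow>
        v i j k = extend_restrict G (D i \<inter> E k) (D i \<inter> E j)"
begin

sublocale double_system I leI J leJ F u v
proof (intro double_system.intro double_system_axioms.intro directed_set_axioms J.directed_set_axioms)
  show "u k l j (u i k j x) = u i l j x"
    if "i \<in> I" "k \<in> I" "l \<in> I" "j \<in> J" "leI i k" "leI k l" for i k l j x
    using that D_mono[of i k] by (auto simp: u_eq extend_restrict_def intro!: restrict_ext)
  show "v i' j k (u i i' k x) = u i i' j (v i j k x)"
    if "i \<in> I" "i' \<in> I" "j \<in> J" "k \<in> J" "leI i i'" "leJ j k" for i i' j k x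
    using that D_mono[of i i'] E_mono[of j k]
    by (auto simp: u_eq v_eq extend_restrict_def intro!: restrict_ext)
qed (simp_all add: F_eq u_eq v_eq coeff comm_group_product_group extend_restrict_hom)

lemma inj_on_u:
  assumes "i \<in> I" "k \<in> I" "j \<in> J" "leI i k"
  shows "inj_on (u i k j) (carrier (F i j))"
proof (rule inj_onI)
  fix x y assume x: "x \<in> carrier (F i j)" and y: "y \<in> carrier (F i j)" and eq: "u i k j x = u i k j y"
  have "x \<sigma> = y \<sigma>" if "\<sigma> \<in> D i \<inter> E j" for \<sigma>
    using fun_cong[OF eq, of \<sigma>] that D_mono[OF assms(1,2,4)] assms
    by (auto simp: u_eq extend_restrict_def)
  moreover have "x \<in> extensional (D i \<inter> E j)" "y \<in> extensional (D i \<inter> E j)"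
    using x y assms by (auto simp: F_eq PiE_def)
  ultimately show "x = y" by (rule extensionalityI[rotated 2])
qed

text \<open>An element of the limit of colimits glues to one function on the union of the sets
  \<open>E j\<close>, whose support within each \<open>E j\<close> lies in some \<open>D i\<close>.
  Surjectivity asks for one \<open>i\<close> that works for all \<open>j\<close>, and this is what
  \<open>cover\<close> provides; injectivity holds because extension by the identity is
  injective.\<close>

lemma interchange_iso:
  assumes cover: "\<And>S. S \<subseteq> \<Union>(E ` J) \<Longrightarrow> (\<And>j. j \<in> J \<Longrightarrow> \<exists>i\<in>I. S \<inter> E j \<subseteq> D i) \<Longrightarrow>
      \<exists>i\<in>I. S \<subseteq> D i"
  shows "interchange I leI J F u \<in> iso CL LC"
proof -
  interpret G: comm_group G by (rule coeff)
  have "c \<in> interchange I leI J F u ` carrier CL" if c: "c \<in> carrier LC" for c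
  proof -
    \<comment> \<open>The index of the representative chosen here may vary with \<open>j\<close>;
      the gluing below removes this dependence.\<close>
    have "\<forall>j\<in>J. \<exists>ix. fst ix \<in> I \<and> snd ix \<in> carrier (F (fst ix) j) \<and> c j = F_cls j (fst ix) (snd ix)"
    proof
      fix j assume j: "j \<in> J"
      then have "c j \<in> carrier (colims j)" using c by (simp add: lim_colim_def lim_group_iff)
      then obtain i x where "i \<in> I" "x \<in> carrier (F i j)" "c j = F_cls j i x"
        by (rule direct_system.colim_elem[OF direct_system_F[OF j]])
      then show "\<exists>ix. fst ix \<in> I \<and> snd ix \<in> carrier (F (fst ix) j) \<and> c j = F_cls j (fst ix) (snd ix)"
        by (intro exI[of _ "(i, x)"]) simp
    qed
    from bchoice[OF this] obtain ix where ix: "\<forall>j\<in>J. fst (ix j) \<in> I \<and>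
        snd (ix j) \<in> carrier (F (fst (ix j)) j) \<and> c j = F_cls j (fst (ix j)) (snd (ix j))" by blast
    define a where "a j = fst (ix j)" for j
    define x where "x j = snd (ix j)" for j
    have a: "a j \<in> I" and x: "x j \<in> carrier (F (a j) j)" and cj: "c j = F_cls j (a j) (x j)"
      if "j \<in> J" for j using ix that by (simp_all add: a_def x_def)
    \<comment> \<open>Extending each representative by the identity makes functions with different
      index sets comparable point by point.\<close>
    define h where "h j \<sigma> = (if \<sigma> \<in> D (a j) \<inter> E j then x j \<sigma> else \<one>\<^bsub>G\<^esub>)" for j \<sigma>
    have h_closed: "h j \<sigma> \<in> carrier G" if "j \<in> J" for j \<sigma>
      using x[OF that] a[OF that] that by (auto simp: h_def F_eq)
    \<comment> \<open>Equality of classes means equality after some extension by the identity, which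
      at a point of \<open>E j\<close> is equality of the extended values.\<close>
    have compat: "h k \<sigma> = h j \<sigma>" if j: "j \<in> J" and k: "k \<in> J" and jk: "leJ j k" and \<sigma>: "\<sigma> \<in> E j" for j k \<sigma>
    proof -
      have "F_cls j (a j) (x j) = colim_v j k (c k)"
        using c j k jk cj[OF j] by (simp add: lim_colim_def lim_group_iff)
      also have "\<dots> = F_cls j (a k) (v (a k) j k (x k))"
        using direct_system_map.colim_map_class[OF direct_system_map_v[OF j k jk] a[OF k] x[OF k]]
          cj[OF k] by simp
      finally have eq: "F_cls j (a j) (x j) = F_cls j (a k) (v (a k) j k (x k))" .
      have vx: "v (a k) j k (x k) \<in> carrier (F (a k) j)"
        using hom_in_carrier[OF v_hom[OF a[OF k] j k jk] x[OF k]] .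
      obtain m where m: "m \<in> I" "leI (a j) m" "leI (a k) m"
          "u (a j) m j (x j) = u (a k) m j (v (a k) j k (x k))"
        using direct_system.class_eq_iff[OF direct_system_F[OF j] a[OF j] x[OF j] a[OF k] vx] eq by blast
      have "\<sigma> \<in> E k" "D (a j) \<subseteq> D m" "D (a k) \<subseteq> D m"
        using E_mono[OF j k jk] D_mono[OF a[OF j] m(1,2)] D_mono[OF a[OF k] m(1,3)] \<sigma> by blast+
      then show ?thesis
        using fun_cong[OF m(4), of \<sigma>] \<sigma> a j k m(1)
        by (auto simp: h_def u_eq v_eq extend_restrict_def subset_iff split: if_splits)
    qed
    \<comment> \<open>Any \<open>j\<close> with \<open>\<sigma>\<close> in \<open>E j\<close> may be
      chosen: two candidates lie below a third index, where \<open>compat\<close> identifies their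
      values.\<close>
    define g where "g \<sigma> = (if \<exists>j\<in>J. \<sigma> \<in> E j then h (SOME j. j \<in> J \<and> \<sigma> \<in> E j) \<sigma> else \<one>\<^bsub>G\<^esub>)" for \<sigma>
    have g_eq: "g \<sigma> = h j \<sigma>" if j: "j \<in> J" and \<sigma>: "\<sigma> \<in> E j" for j \<sigma>
    proof -
      define k where "k = (SOME j. j \<in> J \<and> \<sigma> \<in> E j)"
      have k: "k \<in> J" "\<sigma> \<in> E k"
        using someI[of "\<lambda>j. j \<in> J \<and> \<sigma> \<in> E j" j] that by (auto simp: k_def)
      obtain l where l: "l \<in> J" "leJ j l" "leJ k l" using J.upper_bound[OF j k(1)] .
      have "g \<sigma> = h k \<sigma>" using j \<sigma> by (auto simp: g_def k_def)
      also have "\<dots> = h l \<sigma>" using compat[OF k(1) l(1,3) k(2)] by simp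
      also have "\<dots> = h j \<sigma>" using compat[OF j l(1,2) \<sigma>] .
      finally show ?thesis .
    qed
    have "\<exists>i\<in>I. {\<sigma>. g \<sigma> \<noteq> \<one>\<^bsub>G\<^esub>} \<subseteq> D i"
    proof (rule cover)
      show "{\<sigma>. g \<sigma> \<noteq> \<one>\<^bsub>G\<^esub>} \<subseteq> \<Union>(E ` J)" by (auto simp: g_def split: if_splits)
      fix j assume j: "j \<in> J"
      then have "{\<sigma>. g \<sigma> \<noteq> \<one>\<^bsub>G\<^esub>} \<inter> E j \<subseteq> D (a j)" using g_eq by (auto simp: h_def split: if_splits)
      then show "\<exists>i\<in>I. {\<sigma>. g \<sigma> \<noteq> \<one>\<^bsub>G\<^esub>} \<inter> E j \<subseteq> D i" using a j by blast
    qed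
    then obtain i where i: "i \<in> I" "{\<sigma>. g \<sigma> \<noteq> \<one>\<^bsub>G\<^esub>} \<subseteq> D i" by blast
    then have g_one: "g \<sigma> = \<one>\<^bsub>G\<^esub>" if "\<sigma> \<notin> D i" for \<sigma> using that by blast
    \<comment> \<open>Nothing is lost by cutting down to \<open>D i\<close>, since \<open>g\<close>
      is the identity element outside it.\<close>
    define y where "y = (\<lambda>j\<in>J. \<lambda>\<sigma>\<in>D i \<inter> E j. g \<sigma>)"
    have y: "y \<in> carrier (lims i)"
      unfolding lim_group_iff
    proof (intro conjI ballI impI)
      fix j assume j: "j \<in> J"
      then show "y j \<in> carrier (F i j)" using i(1) g_eq h_closed by (auto simp: y_def F_eq)
      fix k assume k: "k \<in> J" and jk: "leJ j k"
      show "v i j k (y k) = y j"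
        using E_mono[OF j k jk] i(1) j k
        by (auto simp: y_def v_eq extend_restrict_def intro!: restrict_ext)
    qed (simp add: y_def)
    have "F_cls j i (y j) = c j" if j: "j \<in> J" for j
    proof -
      obtain k where k: "k \<in> I" "leI i k" "leI (a j) k" using upper_bound[OF i(1) a[OF j]] .
      have "u i k j (y j) = (\<lambda>\<sigma>\<in>D k \<inter> E j. g \<sigma>)"
        using i(1) j k(1) g_one by (auto simp: u_eq extend_restrict_def y_def intro!: restrict_ext)
      also have "\<dots> = (\<lambda>\<sigma>\<in>D k \<inter> E j. h j \<sigma>)" using g_eq[OF j] by (intro restrict_ext) simp
      also have "\<dots> = u (a j) k j (x j)"
        using j a[OF j] k(1) by (auto simp: u_eq extend_restrict_def h_def intro!: restrict_ext)
      finally have "u i k j (y j) = u (a j) k j (x j)" .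
      moreover have "y j \<in> carrier (F i j)" using y j by (simp add: lim_group_iff)
      ultimately show ?thesis
        using direct_system.class_eq_iff[OF direct_system_F[OF j] i(1) _ a[OF j] x[OF j], of "y j"] k
          cj[OF j] by auto
    qed
    then have "interchange I leI J F u (lim_cls i y) = restrict c J"
      by (simp add: interchange_class[OF i(1) y] restrict_def fun_eq_iff)
    moreover have "restrict c J = c"
      using c by (intro extensional_restrict) (simp add: lim_colim_def lim_group_iff)
    moreover have "lim_cls i y \<in> carrier CL"
      using direct_system.class_in_colim[OF direct_system_lims i(1) y] by (simp add: colim_lim_def)
    ultimately show ?thesis by (intro image_eqI[of _ _ "lim_cls i y"]) simp_all
  qed
  then have "interchange I leI J F u ` carrier CL = carrier LC"
    using hom_in_carrier[OF interchange_hom] by (intro subset_antisym subsetI) (elim imageE, simp_all)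
  then show ?thesis
    using interchange_hom inj_on_interchange[OF inj_on_u] by (auto simp: iso_def bij_betw_def)
qed

end

text \<open>The sets satisfying \<open>Q\<close> form an ideal, and the support of a product lies in
  the union of the supports. Lying in some \<open>K\<close> and missing some \<open>N\<close> are
  both conditions of this kind.\<close>

lemma comm_group_support:
  assumes G: "comm_group G" and "Q {}"
    and Un: "\<And>A B. Q A \<Longrightarrow> Q B \<Longrightarrow> Q (A \<union> B)" and sub: "\<And>A B. Q A \<Longrightarrow> B \<subseteq> A \<Longrightarrow> Q B"
  shows "comm_group ((product_group S (\<lambda>_. G))
      \<lparr>carrier := {g \<in> carrier (product_group S (\<lambda>_. G)). Q (supp G S g)}\<rparr>)"
    (is "comm_group ?H")
proof (rule comm_groupI)
  interpret comm_group G by (rule G)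
  have Qsub: "Q (supp G S h)" if "Q (supp G S f)" "\<And>\<sigma>. \<sigma> \<in> S \<Longrightarrow> f \<sigma> = \<one>\<^bsub>G\<^esub> \<Longrightarrow> h \<sigma> = \<one>\<^bsub>G\<^esub>" for f h
    using that(2) by (intro sub[OF that(1)]) (auto simp: supp_def)
  show "\<one>\<^bsub>?H\<^esub> \<in> carrier ?H" using \<open>Q {}\<close> by (simp add: supp_def)
  fix f assume f: "f \<in> carrier ?H"
  then show "\<one>\<^bsub>?H\<^esub> \<otimes>\<^bsub>?H\<^esub> f = f"
    by (auto simp: PiE_iff extensional_def fun_eq_iff)
  show "\<exists>h\<in>carrier ?H. h \<otimes>\<^bsub>?H\<^esub> f = \<one>\<^bsub>?H\<^esub>"
  proof
    show "(\<lambda>\<sigma>\<in>S. inv\<^bsub>G\<^esub> f \<sigma>) \<in> carrier ?H" using f by (auto intro!: Qsub[of f] simp: PiE_iff)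
    show "(\<lambda>\<sigma>\<in>S. inv\<^bsub>G\<^esub> f \<sigma>) \<otimes>\<^bsub>?H\<^esub> f = \<one>\<^bsub>?H\<^esub>" using f by (auto simp: PiE_iff intro!: restrict_ext)
  qed
  fix h assume h: "h \<in> carrier ?H"
  have "supp G S (\<lambda>\<sigma>\<in>S. f \<sigma> \<otimes>\<^bsub>G\<^esub> h \<sigma>) \<subseteq> supp G S f \<union> supp G S h"
    using f h by (auto simp: supp_def)
  then show "f \<otimes>\<^bsub>?H\<^esub> h \<in> carrier ?H"
    using f h sub[OF Un[of "supp G S f" "supp G S h"]] by (auto simp: PiE_iff)
  show "f \<otimes>\<^bsub>?H\<^esub> h = h \<otimes>\<^bsub>?H\<^esub> f" using f h by (auto simp: PiE_iff m_comm intro!: restrict_ext)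
  fix k assume k: "k \<in> carrier ?H"
  show "f \<otimes>\<^bsub>?H\<^esub> h \<otimes>\<^bsub>?H\<^esub> k = f \<otimes>\<^bsub>?H\<^esub> (h \<otimes>\<^bsub>?H\<^esub> k)"
    using f h k by (auto simp: PiE_iff m_assoc intro!: restrict_ext)
qed

section \<open>Boundaries and coboundaries\<close>

locale coefficient_group = comm_group G for G :: "'g monoid" (structure)
begin

lemma boundary_map_closed:
  assumes "g \<in> S' \<rightarrow>\<^sub>E carrier G"
  shows "boundary_map L ori G S' S g \<in> S \<rightarrow>\<^sub>E carrier G"
  using assms by (auto simp: boundary_map_def intro!: finprod_closed int_pow_closed)

lemma coboundary_map_closed:
  assumes "g \<in> S \<rightarrow>\<^sub>E carrier G"
  shows "coboundary_map L ori G S S' g \<in> S' \<rightarrow>\<^sub>E carrier G"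
  using assms by (auto simp: coboundary_map_def intro!: finprod_closed int_pow_closed)

text \<open>The index set of the product defining the boundary depends on the chain, and
  \<open>finprod\<close> over an infinite set is the identity. Finiteness allows all three products
  to be taken over one common finite set.\<close>

lemma boundary_map_mult:
  assumes g: "g \<in> S' \<rightarrow>\<^sub>E carrier G" and h: "h \<in> S' \<rightarrow>\<^sub>E carrier G"
    and fin: "\<And>\<tau>. \<tau> \<in> S \<Longrightarrow> finite {\<sigma> \<in> S'. \<tau> \<subseteq> cell_boundary L \<sigma> \<and> g \<sigma> \<noteq> \<one>}"
      "\<And>\<tau>. \<tau> \<in> S \<Longrightarrow> finite {\<sigma> \<in> S'. \<tau> \<subseteq> cell_boundary L \<sigma> \<and> h \<sigma> \<noteq> \<one>}"
  shows "boundary_map L ori G S' S (\<lambda>\<sigma>\<in>S'. g \<sigma> \<otimes> h \<sigma>) =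
      (\<lambda>\<tau>\<in>S. boundary_map L ori G S' S g \<tau> \<otimes> boundary_map L ori G S' S h \<tau>)"
proof -
  have gc: "\<sigma> \<in> S' \<Longrightarrow> g \<sigma> \<in> carrier G" and hc: "\<sigma> \<in> S' \<Longrightarrow> h \<sigma> \<in> carrier G" for \<sigma>
    using g h by auto
  have "finprod G (\<lambda>\<sigma>. (\<lambda>\<sigma>\<in>S'. g \<sigma> \<otimes> h \<sigma>) \<sigma> [^] incidence L ori \<sigma> \<tau>)
      {\<sigma> \<in> S'. \<tau> \<subseteq> cell_boundary L \<sigma> \<and> (\<lambda>\<sigma>\<in>S'. g \<sigma> \<otimes> h \<sigma>) \<sigma> \<noteq> \<one>} =
    finprod G (\<lambda>\<sigma>. g \<sigma> [^] incidence L ori \<sigma> \<tau>) {\<sigma> \<in> S'. \<tau> \<subseteq> cell_boundary L \<sigma> \<and> g \<sigma> \<noteq> \<one>} \<otimes>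
    finprod G (\<lambda>\<sigma>. h \<sigma> [^] incidence L ori \<sigma> \<tau>) {\<sigma> \<in> S'. \<tau> \<subseteq> cell_boundary L \<sigma> \<and> h \<sigma> \<noteq> \<one>}"
    (is "?l = finprod G ?g ?A \<otimes> finprod G ?h ?B") if \<tau>: "\<tau> \<in> S" for \<tau>
  proof -
    have f: "finite (?A \<union> ?B)" using fin[OF \<tau>] by simp
    \<comment> \<open>The extra indices are those at which \<open>g\<close> and \<open>h\<close>
      cancel; there the product of the two powers is a power of the identity.\<close>
    have "?l = finprod G (\<lambda>\<sigma>. ?g \<sigma> \<otimes> ?h \<sigma>) (?A \<union> ?B)"
      by (rule finprod_mono_neutral_cong_left[OF f])
        (auto simp: gc hc int_pow_distrib simp flip: int_pow_distrib)
    also have "\<dots> = finprod G ?g (?A \<union> ?B) \<otimes> finprod G ?h (?A \<union> ?B)"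
      by (rule finprod_multf) (auto simp: gc hc)
    also have "finprod G ?g (?A \<union> ?B) = finprod G ?g ?A"
      by (rule finprod_mono_neutral_cong_right[OF f]) (auto simp: gc)
    also have "finprod G ?h (?A \<union> ?B) = finprod G ?h ?B"
      by (rule finprod_mono_neutral_cong_right[OF f]) (auto simp: hc)
    finally show ?thesis .
  qed
  then show ?thesis unfolding boundary_map_def by (intro restrict_ext) simp
qed

lemma coboundary_map_mult:
  assumes g: "g \<in> S \<rightarrow>\<^sub>E carrier G" and h: "h \<in> S \<rightarrow>\<^sub>E carrier G"
  shows "coboundary_map L ori G S S' (\<lambda>\<tau>\<in>S. g \<tau> \<otimes> h \<tau>) =
      (\<lambda>\<sigma>\<in>S'. coboundary_map L ori G S S' g \<sigma> \<otimes> coboundary_map L ori G S S' h \<sigma>)"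
proof -
  have gc: "\<tau> \<in> S \<Longrightarrow> g \<tau> \<in> carrier G" and hc: "\<tau> \<in> S \<Longrightarrow> h \<tau> \<in> carrier G" for \<tau>
    using g h by auto
  have "finprod G (\<lambda>\<tau>. (\<lambda>\<tau>\<in>S. g \<tau> \<otimes> h \<tau>) \<tau> [^] incidence L ori \<sigma> \<tau>) {\<tau> \<in> S. \<tau> \<subseteq> cell_boundary L \<sigma>} =
      finprod G (\<lambda>\<tau>. g \<tau> [^] incidence L ori \<sigma> \<tau> \<otimes> h \<tau> [^] incidence L ori \<sigma> \<tau>)
        {\<tau> \<in> S. \<tau> \<subseteq> cell_boundary L \<sigma>}" for \<sigma>
    by (rule finprod_cong') (auto simp: gc hc int_pow_distrib)
  also have "\<dots> \<sigma> = finprod G (\<lambda>\<tau>. g \<tau> [^] incidence L ori \<sigma> \<tau>) {\<tau> \<in> S. \<tau> \<subseteq> cell_boundary L \<sigma>} \<otimes>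
      finprod G (\<lambda>\<tau>. h \<tau> [^] incidence L ori \<sigma> \<tau>) {\<tau> \<in> S. \<tau> \<subseteq> cell_boundary L \<sigma>}" for \<sigma>
    by (rule finprod_multf) (auto simp: gc hc)
  finally show ?thesis unfolding coboundary_map_def by (intro restrict_ext) simp
qed

text \<open>By \<open>star\<close>, for a fixed \<open>\<tau>\<close> in \<open>T\<close> the cells
  of \<open>S'\<close> having it in their boundary either all survive in \<open>T'\<close> or all
  disappear, according to whether \<open>\<tau>\<close> lies in \<open>S\<close>. Hence the new
  product is the old one or is empty.\<close>

lemma boundary_map_extend_restrict:
  assumes g: "g \<in> S' \<rightarrow>\<^sub>E carrier G"
    and star: "\<And>\<sigma> \<tau>. \<sigma> \<in> S' \<Longrightarrow> \<tau> \<in> T \<Longrightarrow> \<tau> \<subseteq> cell_boundary L \<sigma> \<Longrightarrow> \<tau> \<in> S \<longleftrightarrow> \<sigma> \<in> T'"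
  shows "boundary_map L ori G T' T (extend_restrict G S' T' g) =
      extend_restrict G S T (boundary_map L ori G S' S g)"
proof (rule ext)
  fix \<tau>
  let ?A = "{\<sigma> \<in> T'. \<tau> \<subseteq> cell_boundary L \<sigma> \<and> extend_restrict G S' T' g \<sigma> \<noteq> \<one>}"
  let ?B = "{\<sigma> \<in> S'. \<tau> \<subseteq> cell_boundary L \<sigma> \<and> g \<sigma> \<noteq> \<one>}"
  have A: "?A = {\<sigma> \<in> T' \<inter> S'. \<tau> \<subseteq> cell_boundary L \<sigma> \<and> g \<sigma> \<noteq> \<one>}"
    by (auto simp: extend_restrict_def split: if_splits)
  have eq: "finprod G (\<lambda>\<sigma>. extend_restrict G S' T' g \<sigma> [^] incidence L ori \<sigma> \<tau>) ?A =
      (if \<tau> \<in> S then finprod G (\<lambda>\<sigma>. g \<sigma> [^] incidence L ori \<sigma> \<tau>) ?B else \<one>)" if \<tau>: "\<tau> \<in> T"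
  proof (cases "\<tau> \<in> S")
    case True
    then have "?A = ?B" using star \<tau> unfolding A by blast
    then show ?thesis
      using True g A by (simp, intro finprod_cong') (auto simp: extend_restrict_def)
  next
    case False
    then have A_empty: "?A = {}" using star \<tau> unfolding A by blast
    show ?thesis using False by (simp only: A_empty finprod_empty if_False)
  qed
  show "boundary_map L ori G T' T (extend_restrict G S' T' g) \<tau> =
      extend_restrict G S T (boundary_map L ori G S' S g) \<tau>"
    using eq by (simp add: boundary_map_def extend_restrict_def[of G S T])
qed

text \<open>The mirror image, with \<open>\<sigma>\<close> fixed and its faces varying. If
  \<open>\<sigma>\<close> lies in \<open>S'\<close>, all its faces in \<open>S\<close> lie in
  \<open>T\<close>, and further faces in \<open>T\<close> contribute the identity; finiteness of the
  set of faces justifies dropping them.\<close>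

lemma coboundary_map_extend_restrict:
  assumes g: "g \<in> S \<rightarrow>\<^sub>E carrier G"
    and faces: "\<And>\<sigma>. \<sigma> \<in> T' \<Longrightarrow> finite {\<tau> \<in> S \<union> T. \<tau> \<subseteq> cell_boundary L \<sigma>}"
    and star: "\<And>\<sigma> \<tau>. \<sigma> \<in> T' \<Longrightarrow> \<tau> \<in> S \<Longrightarrow> \<tau> \<subseteq> cell_boundary L \<sigma> \<Longrightarrow> \<tau> \<in> T \<longleftrightarrow> \<sigma> \<in> S'"
  shows "coboundary_map L ori G T T' (extend_restrict G S T g) =
      extend_restrict G S' T' (coboundary_map L ori G S S' g)"
proof (rule ext)
  fix \<sigma>
  let ?f = "\<lambda>\<tau>. extend_restrict G S T g \<tau> [^] incidence L ori \<sigma> \<tau>"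
  let ?A = "{\<tau> \<in> T. \<tau> \<subseteq> cell_boundary L \<sigma>}"
  let ?B = "{\<tau> \<in> S. \<tau> \<subseteq> cell_boundary L \<sigma>}"
  have eq: "finprod G ?f ?A = (if \<sigma> \<in> S' then finprod G (\<lambda>\<tau>. g \<tau> [^] incidence L ori \<sigma> \<tau>) ?B else \<one>)"
    if \<sigma>: "\<sigma> \<in> T'"
  proof (cases "\<sigma> \<in> S'")
    case True
    have "finite (?A \<union> ?B)" using faces[OF \<sigma>] by (rule rev_finite_subset) auto
    moreover have "g \<tau> \<in> carrier G" if "\<tau> \<in> S" for \<tau> using g that by auto
    ultimately have "finprod G ?f ?A = finprod G (\<lambda>\<tau>. g \<tau> [^] incidence L ori \<sigma> \<tau>) ?B"
      using star[OF \<sigma>] True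
      by (intro finprod_mono_neutral_cong) (auto simp: extend_restrict_def)
    then show ?thesis using True by simp
  next
    case False
    then have "finprod G ?f ?A = \<one>"
      using star[OF \<sigma>] by (intro finprod_one_eqI) (auto simp: extend_restrict_def)
    then show ?thesis using False by simp
  qed
  show "coboundary_map L ori G T T' (extend_restrict G S T g) \<sigma> =
      extend_restrict G S' T' (coboundary_map L ori G S S' g) \<sigma>"
    using eq by (simp add: coboundary_map_def extend_restrict_def[of G S'])
qed

end

section \<open>Chains and cochains on a scattered complex\<close>

locale coefficient_complex = scattered_complex L lam X
  for L :: "'a::metric_space cells" and lam X +
  fixes P :: "'a set set" and G :: "'g monoid"
  assumes P: "subcomplex L P" and coeff: "comm_group G"
begin

sublocale G: coefficient_group G using coeff by (rule coefficient_group.intro)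

section \<open>Directedness of the index sets and the covering conditions\<close>

lemma directed_kappa: "directed_set (kappa L) (\<subseteq>)"
proof
  have "{} \<in> kappa L" by (simp add: kappa_def subcomplex_def)
  then show "kappa L \<noteq> {}" by blast
  show "\<exists>K''\<in>kappa L. K \<subseteq> K'' \<and> K' \<subseteq> K''" if "K \<in> kappa L" "K' \<in> kappa L" for K K'
    using Un_in_kappa[OF that] by blast
qed auto

lemma directed_nu: "directed_set (nu L X) (\<supseteq>)"
proof
  have "cells L \<in> nu L X" using Union_cells by (simp add: nu_def subcomplex_def)
  then show "nu L X \<noteq> {}" by blast
  show "\<exists>N''\<in>nu L X. N \<supseteq> N'' \<and> N' \<supseteq> N''" if "N \<in> nu L X" "N' \<in> nu L X" for N N'
    using Int_in_nu[OF that] by blast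
qed auto

lemma face_in_subcomplex:
  assumes "subcomplex L A" "\<sigma> \<in> A" "\<tau> \<in> P" "\<tau> \<subseteq> cell_boundary L \<sigma>" shows "\<tau> \<in> A"
proof -
  have "\<sigma> \<in> cells L" "\<tau> \<in> cells L" using assms P by (auto simp: subcomplex_def)
  moreover have "\<tau> \<subseteq> \<sigma>" using assms(4) cell_boundary_subset[OF \<open>\<sigma> \<in> cells L\<close>] by simp
  ultimately show ?thesis using assms(1,2) by (simp add: subcomplex_def)
qed

text \<open>The covering condition of \<open>interchange_iso\<close> for chains. Outside each
  \<open>N\<close> the set \<open>S\<close> lies in some \<open>K - N\<close>, which is finite, so
  the duality supplies one \<open>K\<close> for all of \<open>S\<close>.\<close>

lemma subset_kappa_if_chain:
  assumes "S \<subseteq> cells_of_dim L n P"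
    and "\<And>N. N \<in> nu L X \<Longrightarrow> \<exists>K\<in>kappa L. S \<inter> cells_of_dim L n (P - N) \<subseteq> cells_of_dim L n (P \<inter> K)"
  shows "\<exists>K\<in>kappa L. S \<subseteq> cells_of_dim L n (P \<inter> K)"
proof -
  have "finite (S - N)" if N: "N \<in> nu L X" for N
  proof -
    obtain K where K: "K \<in> kappa L" "S \<inter> cells_of_dim L n (P - N) \<subseteq> cells_of_dim L n (P \<inter> K)"
      using assms(2)[OF N] by blast
    have "S - N \<subseteq> K - N" using K(2) assms(1) by (auto simp: cells_of_dim_def)
    then show ?thesis using finite_kappa_minus_nu[OF K(1) N] finite_subset by blast
  qed
  moreover have "S \<subseteq> cells L" using assms(1) P by (auto simp: cells_of_dim_def subcomplex_def)
  ultimately obtain K where "K \<in> kappa L" "S \<subseteq> K" using subset_kappa_if_finite_minus_nu by blast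
  then show ?thesis using assms(1) by (intro bexI[of _ K]) (auto simp: cells_of_dim_def)
qed

text \<open>The covering condition for cochains: inside each \<open>K\<close> the set
  \<open>S\<close> is contained in a finite \<open>K - N\<close>, so a single \<open>N\<close> can
  be avoided throughout.\<close>

lemma disjoint_nu_if_cochain:
  assumes "S \<subseteq> cells_of_dim L n P"
    and "\<And>K. K \<in> kappa L \<Longrightarrow> \<exists>N\<in>nu L X. S \<inter> cells_of_dim L n (P \<inter> K) \<subseteq> cells_of_dim L n (P - N)"
  shows "\<exists>N\<in>nu L X. S \<subseteq> cells_of_dim L n (P - N)"
proof -
  have "finite (S \<inter> K)" if K: "K \<in> kappa L" for K
  proof -
    obtain N where N: "N \<in> nu L X" "S \<inter> cells_of_dim L n (P \<inter> K) \<subseteq> cells_of_dim L n (P - N)"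
      using assms(2)[OF K] by blast
    have "S \<inter> K \<subseteq> K - N" using N(2) assms(1) by (auto simp: cells_of_dim_def)
    then show ?thesis using finite_kappa_minus_nu[OF K N(1)] finite_subset by blast
  qed
  moreover have "S \<subseteq> cells L" using assms(1) P by (auto simp: cells_of_dim_def subcomplex_def)
  ultimately obtain N where "N \<in> nu L X" "S \<inter> N = {}" using disjoint_nu_if_finite_Int_kappa by blast
  then show ?thesis using assms(1) by (intro bexI[of _ N]) (auto simp: cells_of_dim_def)
qed

lemma cells_of_dim_diff:
  "cells_of_dim L n (P \<inter> K - P \<inter> K \<inter> N) = cells_of_dim L n (P \<inter> K) \<inter> cells_of_dim L n (P - N)"
  by (auto simp: cells_of_dim_def)

lemma finite_cells_of_dim_diff:
  assumes "K \<in> kappa L" "N \<in> nu L X"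
  shows "finite (cells_of_dim L n (P \<inter> K - P \<inter> K \<inter> N))"
  by (rule finite_subset[OF _ finite_kappa_minus_nu[OF assms]]) (auto simp: cells_of_dim_def)

section \<open>The double systems of relative chains and cochains\<close>

lemma restricted_products_ch:
  "restricted_products (kappa L) (\<subseteq>) (nu L X) (\<supseteq>) G
     (\<lambda>K. cells_of_dim L n (P \<inter> K)) (\<lambda>N. cells_of_dim L n (P - N))
     (ch L G P n) (ch_K L G P n) (ch_N L G P n)"
proof (intro restricted_products.intro restricted_products_axioms.intro directed_kappa directed_nu coeff)
  show "ch L G P n K N =
      product_group (cells_of_dim L n (P \<inter> K) \<inter> cells_of_dim L n (P - N)) (\<lambda>_. G)"
    if "K \<in> kappa L" "N \<in> nu L X" for K N
    unfolding ch_def rel_chains_def cells_of_dim_diff[symmetric]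
    by (rule sum_group_eq_product_group[OF finite_cells_of_dim_diff[OF that] G.is_group])
  show "cells_of_dim L n (P \<inter> K) \<subseteq> cells_of_dim L n (P \<inter> K')" if "K \<subseteq> K'" for K K'
    using that by (auto simp: cells_of_dim_def)
  show "cells_of_dim L n (P - N) \<subseteq> cells_of_dim L n (P - N')" if "N' \<subseteq> N" for N N'
    using that by (auto simp: cells_of_dim_def)
qed (simp_all add: ch_K_def ch_N_def induced_map_eq cells_of_dim_diff)

lemma restricted_products_coch:
  "restricted_products (nu L X) (\<supseteq>) (kappa L) (\<subseteq>) G
     (\<lambda>N. cells_of_dim L n (P - N)) (\<lambda>K. cells_of_dim L n (P \<inter> K))
     (coch L G P n) (coch_N L G P n) (coch_K L G P n)"
proof (intro restricted_products.intro restricted_products_axioms.intro directed_kappa directed_nu coeff)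
  have diff: "cells_of_dim L n (P \<inter> K - P \<inter> K \<inter> N) =
      cells_of_dim L n (P - N) \<inter> cells_of_dim L n (P \<inter> K)" for K N
    by (auto simp: cells_of_dim_def)
  show "coch L G P n N K =
      product_group (cells_of_dim L n (P - N) \<inter> cells_of_dim L n (P \<inter> K)) (\<lambda>_. G)" for N K
    by (simp only: coch_def rel_cochains_def diff)
  show "coch_N L G P n N N' K = extend_restrict G
      (cells_of_dim L n (P - N) \<inter> cells_of_dim L n (P \<inter> K))
      (cells_of_dim L n (P - N') \<inter> cells_of_dim L n (P \<inter> K))" for N N' K
    by (simp only: coch_N_def induced_map_eq diff)
  show "coch_K L G P n N K K' = extend_restrict G
      (cells_of_dim L n (P - N) \<inter> cells_of_dim L n (P \<inter> K'))
      (cells_of_dim L n (P - N) \<inter> cells_of_dim L n (P \<inter> K))" for N K K'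
    by (simp only: coch_K_def induced_map_eq diff)
  show "cells_of_dim L n (P \<inter> K) \<subseteq> cells_of_dim L n (P \<inter> K')" if "K \<subseteq> K'" for K K'
    using that by (auto simp: cells_of_dim_def)
  show "cells_of_dim L n (P - N) \<subseteq> cells_of_dim L n (P - N')" if "N' \<subseteq> N" for N N'
    using that by (auto simp: cells_of_dim_def)
qed

lemma double_system_map_ch_d:
  "double_system_map (kappa L) (\<subseteq>) (nu L X) (\<supseteq>)
     (ch L G P (Suc n)) (ch_K L G P (Suc n)) (ch_N L G P (Suc n))
     (ch L G P n) (ch_K L G P n) (ch_N L G P n) (ch_d L ori G P n)"
proof -
  interpret s: restricted_products "kappa L" "(\<subseteq>)" "nu L X" "(\<supseteq>)" G
    "\<lambda>K. cells_of_dim L (Suc n) (P \<inter> K)" "\<lambda>N. cells_of_dim L (Suc n) (P - N)"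
    "ch L G P (Suc n)" "ch_K L G P (Suc n)" "ch_N L G P (Suc n)"
    by (rule restricted_products_ch)
  interpret t: restricted_products "kappa L" "(\<subseteq>)" "nu L X" "(\<supseteq>)" G
    "\<lambda>K. cells_of_dim L n (P \<inter> K)" "\<lambda>N. cells_of_dim L n (P - N)"
    "ch L G P n" "ch_K L G P n" "ch_N L G P n"
    by (rule restricted_products_ch)
  let ?C = "\<lambda>n K N. cells_of_dim L n (P \<inter> K - P \<inter> K \<inter> N)"
  have sF: "carrier (ch L G P (Suc n) K N) = (?C (Suc n) K N \<rightarrow>\<^sub>E carrier G)"
    if "K \<in> kappa L" "N \<in> nu L X" for K N
    using that by (simp add: s.F_eq cells_of_dim_diff)
  show ?thesis
  proof (intro double_system_map.intro double_system_map_axioms.intro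
      s.double_system_axioms t.double_system_axioms)
    fix K N assume KN: "K \<in> kappa L" "N \<in> nu L X"
    show "ch_d L ori G P n K N \<in> hom (ch L G P (Suc n) K N) (ch L G P n K N)"
      unfolding s.F_eq[OF KN] t.F_eq[OF KN] cells_of_dim_diff[symmetric] ch_d_def rel_boundary_def
    proof (rule homI)
      fix x y
      assume "x \<in> carrier (product_group (?C (Suc n) K N) (\<lambda>_. G))"
        "y \<in> carrier (product_group (?C (Suc n) K N) (\<lambda>_. G))"
      then show "boundary_map L ori G (?C (Suc n) K N) (?C n K N)
          (x \<otimes>\<^bsub>product_group (?C (Suc n) K N) (\<lambda>_. G)\<^esub> y) =
        boundary_map L ori G (?C (Suc n) K N) (?C n K N) x \<otimes>\<^bsub>product_group (?C n K N) (\<lambda>_. G)\<^esub>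
        boundary_map L ori G (?C (Suc n) K N) (?C n K N) y"
        using finite_cells_of_dim_diff[OF KN, of "Suc n"]
        by (simp add: G.boundary_map_mult)
    qed (simp add: G.boundary_map_closed)
  next
    fix K K' N x assume *: "K \<in> kappa L" "K' \<in> kappa L" "N \<in> nu L X" "K \<subseteq> K'"
      and x: "x \<in> carrier (ch L G P (Suc n) K N)"
    show "ch_d L ori G P n K' N (ch_K L G P (Suc n) K K' N x) =
        ch_K L G P n K K' N (ch_d L ori G P n K N x)"
      unfolding ch_d_def rel_boundary_def ch_K_def induced_map_eq
    proof (rule G.boundary_map_extend_restrict)
      show "x \<in> ?C (Suc n) K N \<rightarrow>\<^sub>E carrier G" using x sF * by simp
      \<comment> \<open>Both sides are true: \<open>K\<close> contains the faces of its cells, so no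
        new face appears when the chain is extended to \<open>K'\<close>.\<close>
      show "\<tau> \<in> ?C n K N \<longleftrightarrow> \<sigma> \<in> ?C (Suc n) K' N"
        if "\<sigma> \<in> ?C (Suc n) K N" "\<tau> \<in> ?C n K' N" "\<tau> \<subseteq> cell_boundary L \<sigma>" for \<sigma> \<tau>
        using that * face_in_subcomplex[OF kappa_subcomplex[OF *(1)], of \<sigma> \<tau>]
        by (auto simp: cells_of_dim_def)
    qed
  next
    fix K N N' x assume *: "K \<in> kappa L" "N \<in> nu L X" "N' \<in> nu L X" "N' \<subseteq> N"
      and x: "x \<in> carrier (ch L G P (Suc n) K N')"
    show "ch_d L ori G P n K N (ch_N L G P (Suc n) K N N' x) =
        ch_N L G P n K N N' (ch_d L ori G P n K N' x)"
      unfolding ch_d_def rel_boundary_def ch_N_def induced_map_eq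
    proof (rule G.boundary_map_extend_restrict)
      show "x \<in> ?C (Suc n) K N' \<rightarrow>\<^sub>E carrier G" using x sF * by simp
      \<comment> \<open>Both sides are true again: a cell of \<open>N\<close> has its faces in
        \<open>N\<close>, so a cell with a face outside \<open>N\<close> is itself outside.\<close>
      show "\<tau> \<in> ?C n K N' \<longleftrightarrow> \<sigma> \<in> ?C (Suc n) K N"
        if "\<sigma> \<in> ?C (Suc n) K N'" "\<tau> \<in> ?C n K N" "\<tau> \<subseteq> cell_boundary L \<sigma>" for \<sigma> \<tau>
        using that * face_in_subcomplex[OF nu_subcomplex[OF *(2)], of \<sigma> \<tau>]
        by (auto simp: cells_of_dim_def)
    qed
  qed
qed

lemma double_system_map_coch_d:
  "double_system_map (nu L X) (\<supseteq>) (kappa L) (\<subseteq>)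
     (coch L G P n) (coch_N L G P n) (coch_K L G P n)
     (coch L G P (Suc n)) (coch_N L G P (Suc n)) (coch_K L G P (Suc n)) (coch_d L ori G P n)"
proof -
  interpret s: restricted_products "nu L X" "(\<supseteq>)" "kappa L" "(\<subseteq>)" G
    "\<lambda>N. cells_of_dim L n (P - N)" "\<lambda>K. cells_of_dim L n (P \<inter> K)"
    "coch L G P n" "coch_N L G P n" "coch_K L G P n"
    by (rule restricted_products_coch)
  interpret t: restricted_products "nu L X" "(\<supseteq>)" "kappa L" "(\<subseteq>)" G
    "\<lambda>N. cells_of_dim L (Suc n) (P - N)" "\<lambda>K. cells_of_dim L (Suc n) (P \<inter> K)"
    "coch L G P (Suc n)" "coch_N L G P (Suc n)" "coch_K L G P (Suc n)"
    by (rule restricted_products_coch)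
  let ?C = "\<lambda>n K N. cells_of_dim L n (P \<inter> K - P \<inter> K \<inter> N)"
  \<comment> \<open>Closure finiteness of the complex; the cells available at different pairs
    \<open>K\<close>, \<open>N\<close> are all cells of \<open>L\<close>.\<close>
  have faces: "finite {\<tau> \<in> ?C n K N \<union> ?C n K' N'. \<tau> \<subseteq> cell_boundary L \<sigma>}"
    if "\<sigma> \<in> ?C (Suc n) K'' N''" for K N K' N' K'' N'' \<sigma>
    by (rule finite_subset[OF _ finite_faces[of \<sigma>]])
      (use that P in \<open>auto simp: cells_of_dim_def subcomplex_def\<close>)
  show ?thesis
  proof (intro double_system_map.intro double_system_map_axioms.intro
      s.double_system_axioms t.double_system_axioms)
    fix N K assume "N \<in> nu L X" "K \<in> kappa L"
    show "coch_d L ori G P n N K \<in> hom (coch L G P n N K) (coch L G P (Suc n) N K)"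
      unfolding coch_def rel_cochains_def coch_d_def rel_coboundary_def
      by (rule homI) (simp_all add: G.coboundary_map_closed G.coboundary_map_mult)
  next
    fix N N' K x assume *: "N \<in> nu L X" "N' \<in> nu L X" "K \<in> kappa L" "N' \<subseteq> N"
      and x: "x \<in> carrier (coch L G P n N K)"
    show "coch_d L ori G P n N' K (coch_N L G P n N N' K x) =
        coch_N L G P (Suc n) N N' K (coch_d L ori G P n N K x)"
      unfolding coch_d_def rel_coboundary_def coch_N_def induced_map_eq
    proof (rule G.coboundary_map_extend_restrict)
      show "x \<in> ?C n K N \<rightarrow>\<^sub>E carrier G" using x by (simp add: coch_def rel_cochains_def)
      show "\<tau> \<in> ?C n K N' \<longleftrightarrow> \<sigma> \<in> ?C (Suc n) K N"
        if "\<sigma> \<in> ?C (Suc n) K N'" "\<tau> \<in> ?C n K N" "\<tau> \<subseteq> cell_boundary L \<sigma>" for \<sigma> \<tau>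
        using that * face_in_subcomplex[OF nu_subcomplex[OF *(1)], of \<sigma> \<tau>]
        by (auto simp: cells_of_dim_def)
    qed (rule faces)
  next
    fix N K K' x assume *: "N \<in> nu L X" "K \<in> kappa L" "K' \<in> kappa L" "K \<subseteq> K'"
      and x: "x \<in> carrier (coch L G P n N K')"
    show "coch_d L ori G P n N K (coch_K L G P n N K K' x) =
        coch_K L G P (Suc n) N K K' (coch_d L ori G P n N K' x)"
      unfolding coch_d_def rel_coboundary_def coch_K_def induced_map_eq
    proof (rule G.coboundary_map_extend_restrict)
      show "x \<in> ?C n K' N \<rightarrow>\<^sub>E carrier G" using x by (simp add: coch_def rel_cochains_def)
      show "\<tau> \<in> ?C n K N \<longleftrightarrow> \<sigma> \<in> ?C (Suc n) K' N"
        if "\<sigma> \<in> ?C (Suc n) K N" "\<tau> \<in> ?C n K' N" "\<tau> \<subseteq> cell_boundary L \<sigma>" for \<sigma> \<tau>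
        using that * face_in_subcomplex[OF kappa_subcomplex[OF *(2)], of \<sigma> \<tau>]
        by (auto simp: cells_of_dim_def)
    qed (rule faces)
  qed
qed

lemma chain_interchange_iso:
  "chain_complex_iso (chain_colim_lim L X G P) (chain_colim_lim_d L X ori G P)
     (chain_lim_colim L X G P) (chain_lim_colim_d L X ori G P) (chain_interchange L X G P)"
  unfolding chain_complex_iso_def
proof
  fix n
  interpret restricted_products "kappa L" "(\<subseteq>)" "nu L X" "(\<supseteq>)" G
    "\<lambda>K. cells_of_dim L n (P \<inter> K)" "\<lambda>N. cells_of_dim L n (P - N)"
    "ch L G P n" "ch_K L G P n" "ch_N L G P n"
    by (rule restricted_products_ch)
  interpret d: double_system_map "kappa L" "(\<subseteq>)" "nu L X" "(\<supseteq>)"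
    "ch L G P (Suc n)" "ch_K L G P (Suc n)" "ch_N L G P (Suc n)"
    "ch L G P n" "ch_K L G P n" "ch_N L G P n" "ch_d L ori G P n"
    by (rule double_system_map_ch_d)
  have "interchange (kappa L) (\<subseteq>) (nu L X) (ch L G P n) (ch_K L G P n) \<in> iso CL LC"
  proof (rule interchange_iso)
    fix S assume "S \<subseteq> (\<Union>N\<in>nu L X. cells_of_dim L n (P - N))"
    then have "S \<subseteq> cells_of_dim L n P" by (auto simp: cells_of_dim_def)
    then show "\<exists>K\<in>kappa L. S \<subseteq> cells_of_dim L n (P \<inter> K)"
      if "\<And>N. N \<in> nu L X \<Longrightarrow> \<exists>K\<in>kappa L. S \<inter> cells_of_dim L n (P - N) \<subseteq> cells_of_dim L n (P \<inter> K)"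
      using subset_kappa_if_chain that by blast
  qed
  then show "comm_group (chain_colim_lim L X G P n) \<and> comm_group (chain_lim_colim L X G P n) \<and>
      chain_colim_lim_d L X ori G P n \<in> hom (chain_colim_lim L X G P (Suc n)) (chain_colim_lim L X G P n) \<and>
      chain_lim_colim_d L X ori G P n \<in> hom (chain_lim_colim L X G P (Suc n)) (chain_lim_colim L X G P n) \<and>
      chain_interchange L X G P n \<in> iso (chain_colim_lim L X G P n) (chain_lim_colim L X G P n) \<and>
      (\<forall>x\<in>carrier (chain_colim_lim L X G P (Suc n)).
        chain_interchange L X G P n (chain_colim_lim_d L X ori G P n x) =
        chain_lim_colim_d L X ori G P n (chain_interchange L X G P (Suc n) x))"
    unfolding chain_colim_lim_def chain_lim_colim_def chain_colim_lim_d_def chain_lim_colim_d_def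
      chain_interchange_def
    using comm_group_CL comm_group_LC d.colim_lim_map_hom d.lim_colim_map_hom d.interchange_natural
    by simp
qed

lemma cochain_interchange_iso:
  "cochain_complex_iso (cochain_colim_lim L X G P) (cochain_colim_lim_d L X ori G P)
     (cochain_lim_colim L X G P) (cochain_lim_colim_d L X ori G P) (cochain_interchange L X G P)"
  unfolding cochain_complex_iso_def
proof
  fix n
  interpret restricted_products "nu L X" "(\<supseteq>)" "kappa L" "(\<subseteq>)" G
    "\<lambda>N. cells_of_dim L n (P - N)" "\<lambda>K. cells_of_dim L n (P \<inter> K)"
    "coch L G P n" "coch_N L G P n" "coch_K L G P n"
    by (rule restricted_products_coch)
  interpret d: double_system_map "nu L X" "(\<supseteq>)" "kappa L" "(\<subseteq>)"
    "coch L G P n" "coch_N L G P n" "coch_K L G P n"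
    "coch L G P (Suc n)" "coch_N L G P (Suc n)" "coch_K L G P (Suc n)" "coch_d L ori G P n"
    by (rule double_system_map_coch_d)
  have "interchange (nu L X) (\<supseteq>) (kappa L) (coch L G P n) (coch_N L G P n) \<in> iso CL LC"
  proof (rule interchange_iso)
    fix S assume "S \<subseteq> (\<Union>K\<in>kappa L. cells_of_dim L n (P \<inter> K))"
    then have "S \<subseteq> cells_of_dim L n P" by (auto simp: cells_of_dim_def)
    then show "\<exists>N\<in>nu L X. S \<subseteq> cells_of_dim L n (P - N)"
      if "\<And>K. K \<in> kappa L \<Longrightarrow> \<exists>N\<in>nu L X. S \<inter> cells_of_dim L n (P \<inter> K) \<subseteq> cells_of_dim L n (P - N)"
      using disjoint_nu_if_cochain that by blast
  qed
  then show "comm_group (cochain_colim_lim L X G P n) \<and> comm_group (cochain_lim_colim L X G P n) \<and>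
      cochain_colim_lim_d L X ori G P n \<in> hom (cochain_colim_lim L X G P n) (cochain_colim_lim L X G P (Suc n)) \<and>
      cochain_lim_colim_d L X ori G P n \<in> hom (cochain_lim_colim L X G P n) (cochain_lim_colim L X G P (Suc n)) \<and>
      cochain_interchange L X G P n \<in> iso (cochain_colim_lim L X G P n) (cochain_lim_colim L X G P n) \<and>
      (\<forall>x\<in>carrier (cochain_colim_lim L X G P n).
        cochain_interchange L X G P (Suc n) (cochain_colim_lim_d L X ori G P n x) =
        cochain_lim_colim_d L X ori G P n (cochain_interchange L X G P n x))"
    unfolding cochain_colim_lim_def cochain_lim_colim_def cochain_colim_lim_d_def
      cochain_lim_colim_d_def cochain_interchange_def
    using comm_group_CL comm_group_LC d.colim_lim_map_hom d.lim_colim_map_hom d.interchange_natural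
    by simp
qed

section \<open>The groups of chains and cochains with supports\<close>

lemma supp_subset_cells: "supp G (cells_of_dim L n P) g \<subseteq> cells L"
  using P by (auto simp: supp_def cells_of_dim_def subcomplex_def)

text \<open>Closed subcomplexes and complements of members of \<open>nu\<close> are cofinal in each
  other: the cells outside \<open>N\<close> generate a closed subcomplex, and a closed subcomplex
  misses some \<open>N\<close>. Finiteness on all \<open>F\<close> thus amounts to finiteness
  outside all \<open>N\<close>.\<close>

lemma finite_Int_nu_bar_iff:
  assumes "S \<subseteq> cells L"
  shows "(\<forall>F\<in>nu_bar L. finite (S \<inter> F)) \<longleftrightarrow> (\<exists>K\<in>kappa L. S \<subseteq> K)"
proof
  assume fin: "\<forall>F\<in>nu_bar L. finite (S \<inter> F)"
  have "finite (S - N)" if "N \<in> nu L X" for N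
  proof (rule finite_subset)
    show "S - N \<subseteq> S \<inter> generated L (cells L - N)"
      using assms subset_generated[of "cells L - N" L] by blast
    show "finite (S \<inter> generated L (cells L - N))"
      using fin generated_minus_nu_in_nu_bar[OF that] by blast
  qed
  then show "\<exists>K\<in>kappa L. S \<subseteq> K" using subset_kappa_if_finite_minus_nu[OF assms] by blast
next
  assume "\<exists>K\<in>kappa L. S \<subseteq> K"
  then obtain K where K: "K \<in> kappa L" "S \<subseteq> K" by blast
  show "\<forall>F\<in>nu_bar L. finite (S \<inter> F)"
  proof
    fix F assume "F \<in> nu_bar L"
    then obtain N where "N \<in> nu L X" "N \<inter> F = {}" by (rule nu_disjoint_nu_bar)
    then show "finite (S \<inter> F)"
      using finite_subset[OF _ finite_kappa_minus_nu[OF K(1), of N], of "S \<inter> F"] K(2) by blast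
  qed
qed

lemma subset_nu_bar_iff:
  assumes "S \<subseteq> cells L"
  shows "(\<exists>F\<in>nu_bar L. S \<subseteq> F) \<longleftrightarrow> (\<exists>N\<in>nu L X. S \<inter> N = {})"
proof
  assume "\<exists>F\<in>nu_bar L. S \<subseteq> F"
  then obtain F where "F \<in> nu_bar L" "S \<subseteq> F" by blast
  moreover obtain N where "N \<in> nu L X" "N \<inter> F = {}" using nu_disjoint_nu_bar \<open>F \<in> nu_bar L\<close> .
  ultimately show "\<exists>N\<in>nu L X. S \<inter> N = {}" by blast
next
  assume "\<exists>N\<in>nu L X. S \<inter> N = {}"
  then obtain N where N: "N \<in> nu L X" "S \<inter> N = {}" by blast
  then have "S \<subseteq> generated L (cells L - N)"
    using assms subset_generated[of "cells L - N" L] by blast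
  then show "\<exists>F\<in>nu_bar L. S \<subseteq> F" using generated_minus_nu_in_nu_bar[OF N(1)] by blast
qed

lemma finite_Int_kappa_iff:
  assumes "S \<subseteq> cells L"
  shows "(\<forall>K\<in>kappa L. finite (S \<inter> K)) \<longleftrightarrow> (\<exists>N\<in>nu L X. S \<inter> N = {})"
proof
  assume "\<forall>K\<in>kappa L. finite (S \<inter> K)"
  then show "\<exists>N\<in>nu L X. S \<inter> N = {}" using disjoint_nu_if_finite_Int_kappa[OF assms] by blast
next
  assume "\<exists>N\<in>nu L X. S \<inter> N = {}"
  then obtain N where N: "N \<in> nu L X" "S \<inter> N = {}" by blast
  show "\<forall>K\<in>kappa L. finite (S \<inter> K)"
  proof
    fix K assume "K \<in> kappa L"
    from finite_kappa_minus_nu[OF this N(1)] show "finite (S \<inter> K)"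
      by (rule rev_finite_subset) (use N(2) in blast)
  qed
qed

lemma chains_kappa_eq_chains_nu: "chains_kappa L G P n = chains_nu L G P n"
  by (simp add: chains_kappa_def chains_nu_def finite_Int_nu_bar_iff supp_subset_cells)

text \<open>Avoiding some \<open>N\<close> is the convenient form of the support condition: members
  of \<open>nu\<close> can be intersected, and the faces of a cell of \<open>N\<close> remain in
  \<open>N\<close>, which is what the coboundary needs.\<close>

lemma cochains_nu_eq:
  "cochains_nu L G P n =
     {g \<in> carrier (all_chains L G P n). \<exists>N\<in>nu L X. supp G (cells_of_dim L n P) g \<inter> N = {}}"
  by (simp add: cochains_nu_def subset_nu_bar_iff supp_subset_cells)

lemma cochains_kappa_eq_cochains_nu: "cochains_kappa L G P n = cochains_nu L G P n"
  by (simp add: cochains_kappa_def cochains_nu_eq finite_Int_kappa_iff supp_subset_cells)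

lemma comm_group_chains: "comm_group (subgroup_of_chains L G P n (chains_kappa L G P n))"
  unfolding subgroup_of_chains_def chains_kappa_def all_chains_def
proof (rule comm_group_support[OF coeff])
  interpret directed_set "kappa L" "(\<subseteq>)" by (rule directed_kappa)
  show "\<exists>K\<in>kappa L. {} \<subseteq> K" using nonempty by blast
  show "\<exists>K\<in>kappa L. A \<union> B \<subseteq> K" if "\<exists>K\<in>kappa L. A \<subseteq> K" "\<exists>K\<in>kappa L. B \<subseteq> K" for A B
    using that Un_in_kappa by (meson Un_mono)
qed (meson order_trans)

lemma comm_group_cochains: "comm_group (subgroup_of_chains L G P n (cochains_nu L G P n))"
  unfolding subgroup_of_chains_def cochains_nu_eq all_chains_def
proof (rule comm_group_support[OF coeff])
  interpret directed_set "nu L X" "(\<supseteq>)" by (rule directed_nu)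
  show "\<exists>N\<in>nu L X. {} \<inter> N = {}" using nonempty by blast
  show "\<exists>N\<in>nu L X. (A \<union> B) \<inter> N = {}"
    if AB: "\<exists>N\<in>nu L X. A \<inter> N = {}" "\<exists>N\<in>nu L X. B \<inter> N = {}" for A B
  proof -
    obtain N N' where "N \<in> nu L X" "A \<inter> N = {}" "N' \<in> nu L X" "B \<inter> N' = {}" using AB by blast
    then show ?thesis using Int_in_nu[of N N'] by (intro bexI[of _ "N \<inter> N'"]) auto
  qed
qed blast

text \<open>A cell may lie in the boundary of infinitely many others, so additivity requires that
  only finitely many of these carry the chain: they lie in \<open>K - N\<close>, where
  \<open>K\<close> supports the chain and \<open>N\<close> avoids the given cell. The boundary is
  again supported in \<open>K\<close>, as \<open>K\<close> contains the faces of its cells.\<close>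

lemma supp_boundary_hom:
  "supp_boundary L ori G P n \<in>
     hom (subgroup_of_chains L G P (Suc n) (chains_kappa L G P (Suc n)))
       (subgroup_of_chains L G P n (chains_kappa L G P n))"
proof -
  let ?S = "cells_of_dim L (Suc n) P" and ?T = "cells_of_dim L n P"
  have fin: "finite {\<sigma> \<in> ?S. \<tau> \<subseteq> cell_boundary L \<sigma> \<and> g \<sigma> \<noteq> \<one>\<^bsub>G\<^esub>}"
    if g: "g \<in> chains_kappa L G P (Suc n)" and \<tau>: "\<tau> \<in> ?T" for g \<tau>
  proof -
    obtain K where K: "K \<in> kappa L" "supp G ?S g \<subseteq> K" using g by (auto simp: chains_kappa_def)
    have "\<tau> \<in> P" "{\<tau>} \<subseteq> cells L" using \<tau> P by (auto simp: cells_of_dim_def subcomplex_def)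
    \<comment> \<open>A single cell meets every \<open>K\<close> in a finite set, so the duality
      gives an \<open>N\<close> avoiding it.\<close>
    then obtain N where N: "N \<in> nu L X" "{\<tau>} \<inter> N = {}"
      using disjoint_nu_if_finite_Int_kappa[of "{\<tau>}"] by auto
    have "{\<sigma> \<in> ?S. \<tau> \<subseteq> cell_boundary L \<sigma> \<and> g \<sigma> \<noteq> \<one>\<^bsub>G\<^esub>} \<subseteq> K - N"
      using K(2) N(2) face_in_subcomplex[OF nu_subcomplex[OF N(1)] _ \<open>\<tau> \<in> P\<close>] by (auto simp: supp_def)
    then show ?thesis using finite_kappa_minus_nu[OF K(1) N(1)] finite_subset by blast
  qed
  show ?thesis
  proof (rule homI)
    fix g assume "g \<in> carrier (subgroup_of_chains L G P (Suc n) (chains_kappa L G P (Suc n)))"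
    then have g: "g \<in> chains_kappa L G P (Suc n)" by (simp add: subgroup_of_chains_def)
    then obtain K where K: "K \<in> kappa L" "supp G ?S g \<subseteq> K" by (auto simp: chains_kappa_def)
    have "supp G ?T (supp_boundary L ori G P n g) \<subseteq> K"
    proof (rule ccontr)
      assume "\<not> supp G ?T (supp_boundary L ori G P n g) \<subseteq> K"
      then obtain \<tau> where \<tau>: "\<tau> \<in> ?T" "supp_boundary L ori G P n g \<tau> \<noteq> \<one>\<^bsub>G\<^esub>" "\<tau> \<notin> K"
        by (auto simp: supp_def)
      then have "\<tau> \<in> P" by (simp add: cells_of_dim_def)
      then have star: "{\<sigma> \<in> ?S. \<tau> \<subseteq> cell_boundary L \<sigma> \<and> g \<sigma> \<noteq> \<one>\<^bsub>G\<^esub>} = {}"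
        using face_in_subcomplex[OF kappa_subcomplex[OF K(1)], of _ \<tau>] K(2) \<tau>(3)
        by (auto simp: supp_def)
      have "supp_boundary L ori G P n g \<tau> = \<one>\<^bsub>G\<^esub>"
        using \<tau>(1) by (simp only: supp_boundary_def boundary_map_def restrict_apply star
            G.finprod_empty if_True)
      then show False using \<tau>(2) by simp
    qed
    moreover have "supp_boundary L ori G P n g \<in> ?T \<rightarrow>\<^sub>E carrier G"
      using g unfolding supp_boundary_def
      by (intro G.boundary_map_closed) (simp add: chains_kappa_def all_chains_def)
    ultimately show "supp_boundary L ori G P n g \<in>
        carrier (subgroup_of_chains L G P n (chains_kappa L G P n))"
      using K(1) by (auto simp: subgroup_of_chains_def chains_kappa_def all_chains_def)
  next
    fix g h
    assume "g \<in> carrier (subgroup_of_chains L G P (Suc n) (chains_kappa L G P (Suc n)))"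
      "h \<in> carrier (subgroup_of_chains L G P (Suc n) (chains_kappa L G P (Suc n)))"
    then have gh: "g \<in> chains_kappa L G P (Suc n)" "h \<in> chains_kappa L G P (Suc n)"
      by (simp_all add: subgroup_of_chains_def)
    then have "g \<in> ?S \<rightarrow>\<^sub>E carrier G" "h \<in> ?S \<rightarrow>\<^sub>E carrier G"
      by (simp_all add: chains_kappa_def all_chains_def)
    from G.boundary_map_mult[OF this fin[OF gh(1)] fin[OF gh(2)]]
    show "supp_boundary L ori G P n
        (g \<otimes>\<^bsub>subgroup_of_chains L G P (Suc n) (chains_kappa L G P (Suc n))\<^esub> h) =
      supp_boundary L ori G P n g \<otimes>\<^bsub>subgroup_of_chains L G P n (chains_kappa L G P n)\<^esub>
      supp_boundary L ori G P n h"
      by (simp add: supp_boundary_def subgroup_of_chains_def all_chains_def)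
  qed
qed

text \<open>If \<open>g\<close> is trivial on \<open>N\<close>, so is its coboundary: its value on a
  cell of \<open>N\<close> involves only faces of that cell, and these belong to
  \<open>N\<close>.\<close>

lemma supp_coboundary_hom:
  "supp_coboundary L ori G P n \<in>
     hom (subgroup_of_chains L G P n (cochains_nu L G P n))
       (subgroup_of_chains L G P (Suc n) (cochains_nu L G P (Suc n)))"
proof (rule homI)
  let ?S = "cells_of_dim L (Suc n) P" and ?T = "cells_of_dim L n P"
  fix g assume "g \<in> carrier (subgroup_of_chains L G P n (cochains_nu L G P n))"
  then have g: "g \<in> cochains_nu L G P n" by (simp add: subgroup_of_chains_def)
  then obtain N where N: "N \<in> nu L X" "supp G ?T g \<inter> N = {}" by (auto simp: cochains_nu_eq)
  have "supp_coboundary L ori G P n g \<sigma> = \<one>\<^bsub>G\<^esub>" if \<sigma>: "\<sigma> \<in> ?S" "\<sigma> \<in> N" for \<sigma>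
  proof -
    have "g \<tau> = \<one>\<^bsub>G\<^esub>" if "\<tau> \<in> ?T" "\<tau> \<subseteq> cell_boundary L \<sigma>" for \<tau>
    proof -
      have "\<tau> \<in> N"
        using face_in_subcomplex[OF nu_subcomplex[OF N(1)] \<sigma>(2)] that by (simp add: cells_of_dim_def)
      then show ?thesis using N(2) that(1) by (auto simp: supp_def)
    qed
    then have "finprod G (\<lambda>\<tau>. g \<tau> [^]\<^bsub>G\<^esub> incidence L ori \<sigma> \<tau>) {\<tau> \<in> ?T. \<tau> \<subseteq> cell_boundary L \<sigma>} = \<one>\<^bsub>G\<^esub>"
      by (intro G.finprod_one_eqI) auto
    then show ?thesis using \<sigma>(1) by (simp add: supp_coboundary_def coboundary_map_def)
  qed
  then have "supp G ?S (supp_coboundary L ori G P n g) \<inter> N = {}" by (auto simp: supp_def)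
  moreover have "supp_coboundary L ori G P n g \<in> ?S \<rightarrow>\<^sub>E carrier G"
    using g unfolding supp_coboundary_def
    by (intro G.coboundary_map_closed) (simp add: cochains_nu_eq all_chains_def)
  ultimately show "supp_coboundary L ori G P n g \<in>
      carrier (subgroup_of_chains L G P (Suc n) (cochains_nu L G P (Suc n)))"
    using N(1) by (auto simp: subgroup_of_chains_def cochains_nu_eq all_chains_def)
next
  fix g h
  assume "g \<in> carrier (subgroup_of_chains L G P n (cochains_nu L G P n))"
    "h \<in> carrier (subgroup_of_chains L G P n (cochains_nu L G P n))"
  then show "supp_coboundary L ori G P n
      (g \<otimes>\<^bsub>subgroup_of_chains L G P n (cochains_nu L G P n)\<^esub> h) =
    supp_coboundary L ori G P n g \<otimes>\<^bsub>subgroup_of_chains L G P (Suc n) (cochains_nu L G P (Suc n))\<^esub>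
    supp_coboundary L ori G P n h"
    by (simp add: supp_coboundary_def subgroup_of_chains_def all_chains_def cochains_nu_def
        G.coboundary_map_mult)
qed

end

theorem mainTheorem4:
  fixes X :: "'a::polish_space set"
    and L :: "'a cells"
    and P :: "'a set set"
    and G :: "'g monoid"
    and ori :: "'a set \<Rightarrow> 'a chain set"
  assumes "closed X"
    and "cellulates L (- X)"
    and "scattered_towards L X"
    and "subcomplex L P"
    and "comm_group G"
    and "orientation L ori"
  shows "(\<forall>n. chains_kappa L G P n = chains_nu L G P n \<and>
              cochains_kappa L G P n = cochains_nu L G P n) \<and>
         chain_complex_iso
           (chain_colim_lim L X G P) (chain_colim_lim_d L X ori G P)
           (chain_lim_colim L X G P) (chain_lim_colim_d L X ori G P)
           (chain_interchange L X G P) \<and>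
         cochain_complex_iso
           (cochain_colim_lim L X G P) (cochain_colim_lim_d L X ori G P)
           (cochain_lim_colim L X G P) (cochain_lim_colim_d L X ori G P)
           (cochain_interchange L X G P) \<and>
         chain_complex_iso
           (\<lambda>n. subgroup_of_chains L G P n (chains_kappa L G P n)) (supp_boundary L ori G P)
           (\<lambda>n. subgroup_of_chains L G P n (chains_nu L G P n)) (supp_boundary L ori G P)
           (\<lambda>_. id) \<and>
         cochain_complex_iso
           (\<lambda>n. subgroup_of_chains L G P n (cochains_kappa L G P n)) (supp_coboundary L ori G P)
           (\<lambda>n. subgroup_of_chains L G P n (cochains_nu L G P n)) (supp_coboundary L ori G P)
           (\<lambda>_. id)"
proof -
  obtain lam where lam: "barycentric_coords L lam"
    "\<forall>U\<subseteq>- X. open U \<longleftrightarrow> (\<forall>x\<in>U. \<exists>e>0. \<forall>y\<in>- X. bary_dist L lam x y < e \<longrightarrow> y \<in> U)"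
    and L: "cell_complex L" "\<Union>(cells L) = - X"
    using assms(2) unfolding cellulates_def by (elim conjE exE) metis
  interpret coefficient_complex L lam X P G
    by (intro coefficient_complex.intro coefficient_complex_axioms.intro scattered_complex.intro
        scattered_complex_axioms.intro barycentric_complex.intro lam(1) L assms(3-5)
        lam(2)[rule_format])
  \<comment> \<open>After rewriting by the equalities of the subgroups, source and target of the
    last two isomorphisms coincide, with the same (co)boundary maps.\<close>
  have id: "id \<in> iso H H" for H :: "('a set \<Rightarrow> 'g) monoid" using iso_set_refl[of H] by (simp add: id_def)
  show ?thesis
    using chain_interchange_iso[of ori] cochain_interchange_iso[of ori]
    by (simp add: chains_kappa_eq_chains_nu[symmetric] cochains_kappa_eq_cochains_nu
        chain_complex_iso_def[of _ _ _ _ "\<lambda>_. id"] cochain_complex_iso_def[of _ _ _ _ "\<lambda>_. id"]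
        comm_group_chains comm_group_cochains supp_boundary_hom supp_coboundary_hom id)
qed

end
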